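(* Let $k$ be an algebraically closed field and let $T$ be an algebraic torus of rank $n$ over $k$ (i.e. $T\cong (k^{\times})^n$). Then $\delta(T)=2n$.
   Context: Let $G$ be a linear algebraic group over an algebraically closed field $k$. For a product $X=\prod_{i=1}^m X_i$ of affine $G$-varieties (with the diagonal action) and $I\subseteq\{1,\ldots,m\}$, put $X_I:=\prod_{i\in I}X_i$ and write $x_I\in X_I$ for the projection of $x\in X$; $X_\emptyset$ is a single point. An orbit is closed if it is closed in the Zariski topology. Denote by $\delta(G,X)$ the minimal non-negative integer $\delta$ such that for an arbitrary $x\in X$ with closed $G$-orbit there is a subset $I\subseteq\{1,\ldots,m\}$ with $|I|=\delta$ such that the orbit $G\cdot x_I$ is closed in $X_I$ and has the same dimension as the orbit $G\cdot x$ in $X$. Define $\delta(G)$ as the supremum of $\delta(G,X)$ as $X$ ranges over all finite products of affine $G$-varieties. *)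

theory Defs
  imports
    "HOL-Algebra.Group_Action"
    "HOL-Analysis.Abstract_Topology"
    "HOL-Computational_Algebra.Polynomial"
    "HOL-Library.Extended_Nat"
begin

section \<open>Polynomial functions and the Zariski topology\<close>

text \<open>
  A space of points is a set \<open>S\<close> together with a set \<open>C\<close> of \<open>k\<close>-valued coordinate functions.
  For affine \<open>N\<close>-space these are the \<open>N\<close> coordinates; for a product they are the coordinates of
  all factors, so that products need no reindexing of coordinates.
\<close>

inductive_set poly_funs :: "('p \<Rightarrow> 'k::comm_ring_1) set \<Rightarrow> ('p \<Rightarrow> 'k) set"
  for C :: "('p \<Rightarrow> 'k) set" where
  const: "(\<lambda>_. c) \<in> poly_funs C"
| coord: "f \<in> C \<Longrightarrow> f \<in> poly_funs C"
| add: "f \<in> poly_funs C \<Longrightarrow> g \<in> poly_funs C \<Longrightarrow> (\<lambda>x. f x + g x) \<in> poly_funs C"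
| mult: "f \<in> poly_funs C \<Longrightarrow> g \<in> poly_funs C \<Longrightarrow> (\<lambda>x. f x * g x) \<in> poly_funs C"

definition zero_set :: "'p set \<Rightarrow> ('p \<Rightarrow> 'k::comm_ring_1) set \<Rightarrow> 'p set" where
  "zero_set S F = {x \<in> S. \<forall>f\<in>F. f x = 0}"

definition zariski :: "'p set \<Rightarrow> ('p \<Rightarrow> 'k::comm_ring_1) set \<Rightarrow> 'p topology" where
  "zariski S C = topology (\<lambda>U. \<exists>F \<subseteq> poly_funs C. U = S - zero_set S F)"

lemma istopology_zariski:
  fixes C :: "('p \<Rightarrow> 'k::idom) set"
  shows "istopology (\<lambda>U. \<exists>F \<subseteq> poly_funs C. U = S - zero_set S F)"
  unfolding istopology_def
proof (intro conjI allI impI)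
  fix U V
  assume "\<exists>F \<subseteq> poly_funs C. U = S - zero_set S F" "\<exists>F \<subseteq> poly_funs C. V = S - zero_set S F"
  then obtain F G where F: "F \<subseteq> poly_funs C" "U = S - zero_set S F"
    and G: "G \<subseteq> poly_funs C" "V = S - zero_set S G"
    by blast
  let ?H = "{\<lambda>x. f x * g x | f g. f \<in> F \<and> g \<in> G}"
  have "?H \<subseteq> poly_funs C"
    using F(1) G(1) by (auto intro!: poly_funs.mult)
  moreover have "U \<inter> V = S - zero_set S ?H"
    unfolding F(2) G(2) zero_set_def by fastforce
  ultimately show "\<exists>F \<subseteq> poly_funs C. U \<inter> V = S - zero_set S F"
    by blast
next
  fix \<K> :: "'p set set"
  assume "\<forall>K\<in>\<K>. \<exists>F \<subseteq> poly_funs C. K = S - zero_set S F"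
  then obtain F where F: "\<And>K. K \<in> \<K> \<Longrightarrow> F K \<subseteq> poly_funs C"
    "\<And>K. K \<in> \<K> \<Longrightarrow> K = S - zero_set S (F K)"
    by metis
  have "\<Union>\<K> = (\<Union>K\<in>\<K>. S - zero_set S (F K))"
    using F(2) by blast
  also have "\<dots> = S - zero_set S (\<Union>K\<in>\<K>. F K)"
    by (auto simp: zero_set_def)
  finally show "\<exists>F \<subseteq> poly_funs C. \<Union>\<K> = S - zero_set S F"
    using F(1) by (intro exI[of _ "\<Union>K\<in>\<K>. F K"]) auto
qed

lemma openin_zariski:
  fixes C :: "('p \<Rightarrow> 'k::idom) set"
  shows "openin (zariski S C) U \<longleftrightarrow> (\<exists>F \<subseteq> poly_funs C. U = S - zero_set S F)"
  unfolding zariski_def by (simp add: istopology_zariski)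

lemma topspace_zariski:
  fixes C :: "('p \<Rightarrow> 'k::idom) set"
  shows "topspace (zariski S C) = S"
proof -
  have "openin (zariski S C) S"
    unfolding openin_zariski
    by (rule exI[of _ "{\<lambda>_. 1}"]) (auto simp: zero_set_def poly_funs.const)
  then show ?thesis
    unfolding topspace_def openin_zariski by blast
qed

lemma closedin_zariski:
  fixes C :: "('p \<Rightarrow> 'k::idom) set"
  shows "closedin (zariski S C) Z \<longleftrightarrow> (\<exists>F \<subseteq> poly_funs C. Z = zero_set S F)"
proof
  assume "closedin (zariski S C) Z"
  then obtain F where F: "Z \<subseteq> S" "F \<subseteq> poly_funs C" "S - Z = S - zero_set S F"
    unfolding closedin_def topspace_zariski openin_zariski by blast
  moreover have "zero_set S F \<subseteq> S"
    by (auto simp: zero_set_def)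
  ultimately have "Z = zero_set S F"
    by blast
  then show "\<exists>F \<subseteq> poly_funs C. Z = zero_set S F"
    using F(2) by blast
next
  assume "\<exists>F \<subseteq> poly_funs C. Z = zero_set S F"
  then show "closedin (zariski S C) Z"
    unfolding closedin_def topspace_zariski openin_zariski by (auto simp: zero_set_def)
qed

section \<open>Krull dimension\<close>

definition irreducible_in :: "'a topology \<Rightarrow> 'a set \<Rightarrow> bool" where
  "irreducible_in X Z \<longleftrightarrow> Z \<subseteq> topspace X \<and> Z \<noteq> {} \<and>
     (\<forall>A B. closedin X A \<longrightarrow> closedin X B \<longrightarrow> Z \<subseteq> A \<union> B \<longrightarrow> Z \<subseteq> A \<or> Z \<subseteq> B)"

text \<open>
  The empty space gets dimension \<open>0\<close>; below, the dimension is only taken of orbits, which are nonempty.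
\<close>

definition krull_dim :: "'a topology \<Rightarrow> enat" where
  "krull_dim X = Sup {enat d | d. \<exists>Z :: nat \<Rightarrow> 'a set.
     (\<forall>i\<le>d. closedin X (Z i) \<and> irreducible_in X (Z i)) \<and> (\<forall>i<d. Z i \<subset> Z (Suc i))}"

section \<open>Affine varieties and linear algebraic groups\<close>

definition affine_space :: "nat \<Rightarrow> (nat \<Rightarrow> 'k) set" where
  "affine_space N = {..<N} \<rightarrow>\<^sub>E UNIV"

definition coords :: "nat \<Rightarrow> ((nat \<Rightarrow> 'k) \<Rightarrow> 'k) set" where
  "coords N = (\<lambda>j x. x j) ` {..<N}"

text \<open>
  Affine varieties are Zariski closed subsets of affine spaces over an algebraically closed field;
  they need not be irreducible.
\<close>

definition affine_variety :: "nat \<Rightarrow> (nat \<Rightarrow> 'k::alg_closed_field) set \<Rightarrow> bool" where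
  "affine_variety N X \<longleftrightarrow> closedin (zariski (affine_space N) (coords N)) X"

definition pair_coords :: "('p \<Rightarrow> 'k) set \<Rightarrow> ('q \<Rightarrow> 'k) set \<Rightarrow> ('p \<times> 'q \<Rightarrow> 'k) set" where
  "pair_coords C D = (\<lambda>f z. f (fst z)) ` C \<union> (\<lambda>f z. f (snd z)) ` D"

definition morphism ::
    "'p set \<Rightarrow> ('p \<Rightarrow> 'k::comm_ring_1) set \<Rightarrow> nat \<Rightarrow> (nat \<Rightarrow> 'k) set \<Rightarrow> ('p \<Rightarrow> nat \<Rightarrow> 'k) \<Rightarrow> bool" where
  "morphism S C N Y f \<longleftrightarrow> f \<in> S \<rightarrow> Y \<and> (\<forall>j<N. \<exists>p \<in> poly_funs C. \<forall>x\<in>S. f x j = p x)"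

text \<open>The field \<open>gdim\<close> is the dimension of the ambient affine space, not of the group.\<close>

record 'k alg_group = "(nat \<Rightarrow> 'k) monoid" +
  gdim :: nat

definition linear_algebraic_group :: "'k::alg_closed_field alg_group \<Rightarrow> bool" where
  "linear_algebraic_group G \<longleftrightarrow> group G \<and> affine_variety (gdim G) (carrier G) \<and>
     morphism (carrier G \<times> carrier G) (pair_coords (coords (gdim G)) (coords (gdim G)))
       (gdim G) (carrier G) (\<lambda>(g, h). g \<otimes>\<^bsub>G\<^esub> h) \<and>
     morphism (carrier G) (coords (gdim G)) (gdim G) (carrier G) (\<lambda>g. inv\<^bsub>G\<^esub> g)"

text \<open>
  The inverse is required to be a morphism separately: in positive characteristic a bijective
  morphism of algebraic groups need not be an isomorphism.
\<close>

definition alg_group_iso :: "'k::alg_closed_field alg_group \<Rightarrow> 'k alg_group \<Rightarrow> bool" where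
  "alg_group_iso G H \<longleftrightarrow> (\<exists>\<phi> \<in> iso G H.
     morphism (carrier G) (coords (gdim G)) (gdim H) (carrier H) \<phi> \<and>
     morphism (carrier H) (coords (gdim H)) (gdim G) (carrier G) (inv_into (carrier G) \<phi>))"

text \<open>
  \<open>(k\<^sup>\<times>)\<^sup>n\<close> with componentwise multiplication, as the closed subset
  \<open>{(t, s). \<forall>i<n. t\<^sub>i s\<^sub>i = 1}\<close> of affine \<open>2n\<close>-space.
\<close>

definition std_torus :: "nat \<Rightarrow> 'k::alg_closed_field alg_group" where
  "std_torus n =
     \<lparr>carrier = {x \<in> affine_space (2 * n). \<forall>i<n. x i * x (n + i) = 1},
      monoid.mult = (\<lambda>x y. \<lambda>j\<in>{..<2 * n}. x j * y j),
      monoid.one = (\<lambda>j\<in>{..<2 * n}. 1),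
      gdim = 2 * n\<rparr>"

definition algebraic_torus :: "nat \<Rightarrow> 'k::alg_closed_field alg_group \<Rightarrow> bool" where
  "algebraic_torus n T \<longleftrightarrow> linear_algebraic_group T \<and> alg_group_iso T (std_torus n)"

section \<open>Affine \<open>G\<close>-varieties and their finite products\<close>

record 'k gvar =
  vdim :: nat
  pts :: "(nat \<Rightarrow> 'k) set"
  act :: "(nat \<Rightarrow> 'k) \<Rightarrow> (nat \<Rightarrow> 'k) \<Rightarrow> (nat \<Rightarrow> 'k)"

definition affine_G_variety :: "'k::alg_closed_field alg_group \<Rightarrow> 'k gvar \<Rightarrow> bool" where
  "affine_G_variety G X \<longleftrightarrow> affine_variety (vdim X) (pts X) \<and> group_action G (pts X) (act X) \<and>
     morphism (carrier G \<times> pts X) (pair_coords (coords (gdim G)) (coords (vdim X)))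
       (vdim X) (pts X) (\<lambda>(g, x). act X g x)"

definition prod_pts :: "nat set \<Rightarrow> (nat \<Rightarrow> 'k gvar) \<Rightarrow> (nat \<Rightarrow> nat \<Rightarrow> 'k) set" where
  "prod_pts I X = (\<Pi>\<^sub>E i\<in>I. pts (X i))"

definition prod_zariski ::
    "nat set \<Rightarrow> (nat \<Rightarrow> 'k::alg_closed_field gvar) \<Rightarrow> (nat \<Rightarrow> nat \<Rightarrow> 'k) topology" where
  "prod_zariski I X = zariski (prod_pts I X) {\<lambda>x. f (x i) | i f. i \<in> I \<and> f \<in> coords (vdim (X i))}"

definition diag_act ::
    "nat set \<Rightarrow> (nat \<Rightarrow> 'k gvar) \<Rightarrow> (nat \<Rightarrow> 'k) \<Rightarrow> (nat \<Rightarrow> nat \<Rightarrow> 'k) \<Rightarrow> (nat \<Rightarrow> nat \<Rightarrow> 'k)" where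
  "diag_act I X g = (\<lambda>x\<in>prod_pts I X. \<lambda>i\<in>I. act (X i) g (x i))"

definition prod_orbit ::
    "'k alg_group \<Rightarrow> nat set \<Rightarrow> (nat \<Rightarrow> 'k gvar) \<Rightarrow> (nat \<Rightarrow> nat \<Rightarrow> 'k) \<Rightarrow> (nat \<Rightarrow> nat \<Rightarrow> 'k) set" where
  "prod_orbit G I X x = orbit G (diag_act I X) x"

definition closed_orbit ::
    "'k::alg_closed_field alg_group \<Rightarrow> nat set \<Rightarrow> (nat \<Rightarrow> 'k gvar) \<Rightarrow> (nat \<Rightarrow> nat \<Rightarrow> 'k) \<Rightarrow> bool" where
  "closed_orbit G I X x \<longleftrightarrow> closedin (prod_zariski I X) (prod_orbit G I X x)"

definition orbit_dim ::
    "'k::alg_closed_field alg_group \<Rightarrow> nat set \<Rightarrow> (nat \<Rightarrow> 'k gvar) \<Rightarrow> (nat \<Rightarrow> nat \<Rightarrow> 'k) \<Rightarrow> enat" where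
  "orbit_dim G I X x = krull_dim (subtopology (prod_zariski I X) (prod_orbit G I X x))"

section \<open>The invariant \<open>\<delta>\<close>\<close>

definition delta_prod_bound ::
    "'k::alg_closed_field alg_group \<Rightarrow> nat \<Rightarrow> (nat \<Rightarrow> 'k gvar) \<Rightarrow> nat \<Rightarrow> bool" where
  "delta_prod_bound G m X d \<longleftrightarrow> (\<forall>x \<in> prod_pts {1..m} X. closed_orbit G {1..m} X x \<longrightarrow>
     (\<exists>I \<subseteq> {1..m}. card I = d \<and> closed_orbit G I X (restrict x I) \<and>
        orbit_dim G I X (restrict x I) = orbit_dim G {1..m} X x))"

definition delta_prod :: "'k::alg_closed_field alg_group \<Rightarrow> nat \<Rightarrow> (nat \<Rightarrow> 'k gvar) \<Rightarrow> nat" where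
  "delta_prod G m X = (LEAST d. delta_prod_bound G m X d)"

text \<open>The number \<open>m\<close> of factors always qualifies, so the minimum exists.\<close>

lemma delta_prod_bound_full: "delta_prod_bound G m X m"
  unfolding delta_prod_bound_def
proof (intro ballI impI)
  fix x assume x: "x \<in> prod_pts {1..m} X" and "closed_orbit G {1..m} X x"
  moreover have "restrict x {1..m} = x"
    using x unfolding prod_pts_def by (rule PiE_restrict)
  ultimately show "\<exists>I \<subseteq> {1..m}. card I = m \<and> closed_orbit G I X (restrict x I) \<and>
      orbit_dim G I X (restrict x I) = orbit_dim G {1..m} X x"
    by (intro exI[of _ "{1..m}"]) simp
qed

definition delta :: "'k::alg_closed_field alg_group \<Rightarrow> enat" where
  "delta G = Sup {enat (delta_prod G m X) | m X. \<forall>i\<in>{1..m}. affine_G_variety G (X i)}"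

end

theory Submission
  imports Defs "HOL-Library.Function_Algebras"
begin

text \<open>
  The orbit of a point \<open>x\<close> is governed by the finite set \<open>W\<close> of weights occurring in the coordinates
  of \<open>t \<cdot> x\<close>: the coordinate ring of the orbit closure is spanned by the characters in the monoid
  generated by \<open>W\<close>. Hence the orbit is closed iff this monoid is a group, and then its dimension is
  the rank of that group. For a product the sets of weights are united, so a minimal choice of
  factors is a question on positively spanning sets of vectors in dimension \<open>n\<close>: by Steinitz'
  theorem \<open>2n\<close> vectors suffice, and the vectors \<open>\<plusminus>e\<^sub>i\<close> show that \<open>2n\<close> are needed.

  The rank enters as the number of leading indices of lattice vectors. It bounds the Krull dimension
  from above by the growth of the space of functions, and from below by a chain of orbits of
  coordinate subtori.
\<close>


section \<open>Polynomial functions\<close>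

text \<open>A weight occurring in a coordinate is itself a regular function on the orbit for the
  following reason: the coefficients of the expansion of \<open>t \<cdot> y\<close> are polynomials
  in \<open>y\<close>, and expanding \<open>(s t) \<cdot> x\<close> in two ways shows that on the
  orbit they transform by characters. A coefficient that is nonzero at \<open>x\<close> can thus be
  normalised to the character itself.

  Two features shape the combinatorics. A factor contributes all of its weights at once, and adding
  weights can destroy closedness of an orbit, so Steinitz' theorem is proved in a form that survives
  enlarging the chosen vectors within the weights of a closed orbit. Moreover the chosen vectors
  generate in general only a subgroup of finite index, so membership is claimed for positive
  multiples; leading indices do not see the difference.

  Rank and chains of closed irreducible sets are compared by counting: a lattice of rank
  \<open>r\<close> has about \<open>m ^ r\<close> points in a box of side \<open>m\<close>, and
  \<open>d\<close> independent functions have about \<open>m ^ d\<close> monomials with exponents up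
  to \<open>m\<close>.\<close>

lemma poly_funs_sum:
  assumes "\<And>u. u \<in> K \<Longrightarrow> c u \<in> poly_funs D"
  shows "(\<lambda>x. \<Sum>u\<in>K. c u x) \<in> poly_funs D"
  using assms
proof (induction K rule: infinite_finite_induct)
  case (insert u K)
  then show ?case
    using poly_funs.add[of "c u" D "\<lambda>x. \<Sum>u\<in>K. c u x"] by simp
qed (auto intro: poly_funs.const)

lemma poly_funs_cmult: "f \<in> poly_funs D \<Longrightarrow> (\<lambda>x. a * f x) \<in> poly_funs D"
  by (intro poly_funs.mult poly_funs.const)

lemma poly_funs_diff:
  assumes "f \<in> poly_funs D" "g \<in> poly_funs D"
  shows "(\<lambda>x. f x - g x) \<in> poly_funs D"
  using poly_funs.add[OF assms(1) poly_funs_cmult[OF assms(2), of "-1"]] by simp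

lemma poly_funs_comp:
  assumes "f \<in> poly_funs C" "\<And>g. g \<in> C \<Longrightarrow> (\<lambda>x. g (h x)) \<in> poly_funs D"
  shows "(\<lambda>x. f (h x)) \<in> poly_funs D"
  using assms(1)
  by induction (auto intro: assms(2) poly_funs.const poly_funs.add poly_funs.mult)

section \<open>Laurent expansions\<close>

text \<open>
  The parameter \<open>y\<close> is a point of a \<open>G\<close>-variety: the coordinates of \<open>t \<cdot> y\<close> are Laurent polynomials in
  \<open>t\<close> with coefficients depending polynomially on \<open>y\<close>.
\<close>

definition laurent ::
    "'a set \<Rightarrow> ('u \<Rightarrow> 'a \<Rightarrow> 'k::comm_ring_1) \<Rightarrow> ('q \<Rightarrow> 'k) set \<Rightarrow> 'u set \<Rightarrow> ('a \<Rightarrow> 'q \<Rightarrow> 'k) \<Rightarrow> bool" where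
  "laurent A e D K g \<longleftrightarrow> (\<exists>c. (\<forall>u\<in>K. c u \<in> poly_funs D) \<and>
     (\<forall>a\<in>A. \<forall>y. g a y = (\<Sum>u\<in>K. c u y * e u a)))"

lemma laurent_mono:
  assumes "laurent A e D K g" "K \<subseteq> K'" "finite K'"
  shows "laurent A e D K' g"
proof -
  obtain c where c: "\<And>u. u \<in> K \<Longrightarrow> c u \<in> poly_funs D"
    "\<And>a y. a \<in> A \<Longrightarrow> g a y = (\<Sum>u\<in>K. c u y * e u a)"
    using assms(1) unfolding laurent_def by blast
  define c' where "c' u = (if u \<in> K then c u else (\<lambda>_. 0))" for u
  have "(\<Sum>u\<in>K'. c' u y * e u a) = (\<Sum>u\<in>K. c u y * e u a)" for a y
    using assms(2,3) by (intro sum.mono_neutral_cong_right) (auto simp: c'_def)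
  then show ?thesis
    unfolding laurent_def using c
    by (intro exI[of _ c']) (auto simp: c'_def intro: poly_funs.const)
qed

lemma laurent_const: "laurent A e D {u} (\<lambda>a y. c y * e u a)" if "c \<in> poly_funs D"
  unfolding laurent_def using that by (intro exI[of _ "\<lambda>_. c"]) auto

lemma laurent_add:
  assumes "laurent A e D K g" "laurent A e D K h"
  shows "laurent A e D K (\<lambda>a y. g a y + h a y)"
proof -
  obtain c where c: "\<And>u. u \<in> K \<Longrightarrow> c u \<in> poly_funs D"
    "\<And>a y. a \<in> A \<Longrightarrow> g a y = (\<Sum>u\<in>K. c u y * e u a)"
    using assms(1) unfolding laurent_def by blast
  obtain d where d: "\<And>u. u \<in> K \<Longrightarrow> d u \<in> poly_funs D"
    "\<And>a y. a \<in> A \<Longrightarrow> h a y = (\<Sum>u\<in>K. d u y * e u a)"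
    using assms(2) unfolding laurent_def by blast
  show ?thesis
    unfolding laurent_def
    using c d by (intro exI[of _ "\<lambda>u y. c u y + d u y"])
      (auto simp: sum.distrib algebra_simps intro: poly_funs.add)
qed

lemma laurent_mult:
  fixes e :: "'u::plus \<Rightarrow> 'a \<Rightarrow> 'k::comm_ring_1"
  assumes "laurent A e D K g" "laurent A e D L h" "finite K" "finite L"
    and e: "\<And>u v a. u \<in> K \<Longrightarrow> v \<in> L \<Longrightarrow> a \<in> A \<Longrightarrow> e (u + v) a = e u a * e v a"
  shows "laurent A e D ((\<lambda>(u, v). u + v) ` (K \<times> L)) (\<lambda>a y. g a y * h a y)"
proof -
  obtain c where c: "\<And>u. u \<in> K \<Longrightarrow> c u \<in> poly_funs D"
    "\<And>a y. a \<in> A \<Longrightarrow> g a y = (\<Sum>u\<in>K. c u y * e u a)"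
    using assms(1) unfolding laurent_def by blast
  obtain d where d: "\<And>u. u \<in> L \<Longrightarrow> d u \<in> poly_funs D"
    "\<And>a y. a \<in> A \<Longrightarrow> h a y = (\<Sum>u\<in>L. d u y * e u a)"
    using assms(2) unfolding laurent_def by blast
  let ?s = "\<lambda>(u, v). u + v"
  let ?F = "\<lambda>w. {p \<in> K \<times> L. ?s p = w}"
  define b where "b w y = (\<Sum>p\<in>?F w. c (fst p) y * d (snd p) y)" for w y
  have "b w \<in> poly_funs D" for w
    unfolding b_def using c(1) d(1) by (intro poly_funs_sum poly_funs.mult) auto
  moreover have "g a y * h a y = (\<Sum>w\<in>?s ` (K \<times> L). b w y * e w a)" if a: "a \<in> A" for a y
  proof -
    have "g a y * h a y = (\<Sum>p\<in>K \<times> L. c (fst p) y * e (fst p) a * (d (snd p) y * e (snd p) a))"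
      unfolding c(2)[OF a] d(2)[OF a] sum_product by (simp add: sum.cartesian_product case_prod_unfold)
    also have "\<dots> = (\<Sum>p\<in>K \<times> L. c (fst p) y * d (snd p) y * e (?s p) a)"
      using e a by (intro sum.cong) auto
    also have "\<dots> = (\<Sum>w\<in>?s ` (K \<times> L). \<Sum>p\<in>?F w. c (fst p) y * d (snd p) y * e (?s p) a)"
      using assms(3,4) by (intro sum.image_gen) auto
    also have "\<dots> = (\<Sum>w\<in>?s ` (K \<times> L). b w y * e w a)"
      unfolding b_def sum_distrib_right by (intro sum.cong) auto
    finally show ?thesis .
  qed
  ultimately show ?thesis
    unfolding laurent_def by blast
qed

text \<open>Multiplicativity of \<open>e\<close> is asked for on the submonoid \<open>M\<close>.
  Thus the lemma serves both for genuine characters and for the degenerate evaluation that builds a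
  limit point of an orbit, which is shown to be multiplicative on \<open>mon_hull W\<close>.\<close>

lemma laurent_poly:
  fixes e :: "'u::monoid_add \<Rightarrow> 'a \<Rightarrow> 'k::comm_ring_1"
  assumes f: "f \<in> poly_funs C"
    and C: "\<And>f. f \<in> C \<Longrightarrow> \<exists>K. finite K \<and> K \<subseteq> M \<and> laurent A e D K (\<lambda>a y. f (h a y))"
    and M: "0 \<in> M" "\<And>u v. u \<in> M \<Longrightarrow> v \<in> M \<Longrightarrow> u + v \<in> M"
    and e: "\<And>a. a \<in> A \<Longrightarrow> e 0 a = 1"
      "\<And>u v a. u \<in> M \<Longrightarrow> v \<in> M \<Longrightarrow> a \<in> A \<Longrightarrow> e (u + v) a = e u a * e v a"
  shows "\<exists>K. finite K \<and> K \<subseteq> M \<and> laurent A e D K (\<lambda>a y. f (h a y))"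
  using f
proof induction
  case (const c)
  have "laurent A e D {0} (\<lambda>a y. c)"
    unfolding laurent_def using e(1) by (intro exI[of _ "\<lambda>_ _. c"]) (auto intro: poly_funs.const)
  with M(1) show ?case
    by (intro exI[of _ "{0}"]) auto
next
  case (add f g)
  then obtain K L where "finite K" "K \<subseteq> M" "laurent A e D K (\<lambda>a y. f (h a y))"
    "finite L" "L \<subseteq> M" "laurent A e D L (\<lambda>a y. g (h a y))"
    by blast
  then show ?case
    by (intro exI[of _ "K \<union> L"] conjI laurent_add) (auto elim: laurent_mono)
next
  case (mult f g)
  then obtain K L where *: "finite K" "K \<subseteq> M" "laurent A e D K (\<lambda>a y. f (h a y))"
    "finite L" "L \<subseteq> M" "laurent A e D L (\<lambda>a y. g (h a y))"
    by blast
  then have "laurent A e D ((\<lambda>(u, v). u + v) ` (K \<times> L)) (\<lambda>a y. f (h a y) * g (h a y))"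
    using e(2) by (intro laurent_mult) blast+
  with * M(2) show ?case
    by (intro exI[of _ "(\<lambda>(u, v). u + v) ` (K \<times> L)"]) auto
qed (use C in blast)

section \<open>Characters of the torus\<close>

text \<open>Points and weights are total functions on the naturals, which keeps their multiplication
  and addition pointwise. The entries of a point from \<open>n\<close> on are arbitrary and ignored
  by \<open>ch\<close>; those of a weight are \<open>0\<close>, so that a weight is determined by
  its first \<open>n\<close> entries.\<close>

definition torus :: "nat \<Rightarrow> (nat \<Rightarrow> 'k::field) set" where
  "torus n = {s. \<forall>i<n. s i \<noteq> 0}"

definition weights :: "nat \<Rightarrow> (nat \<Rightarrow> int) set" where
  "weights n = {u. \<forall>i\<ge>n. u i = 0}"

definition ch :: "nat \<Rightarrow> (nat \<Rightarrow> int) \<Rightarrow> (nat \<Rightarrow> 'k::field) \<Rightarrow> 'k" where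
  "ch n u s = (\<Prod>i<n. s i powi u i)"

lemma weights_add: "u \<in> weights n \<Longrightarrow> v \<in> weights n \<Longrightarrow> u + v \<in> weights n"
  and weights_0: "0 \<in> weights n"
  by (auto simp: weights_def)

lemma ch_0: "ch n 0 s = 1"
  by (simp add: ch_def)

lemma ch_add: "s \<in> torus n \<Longrightarrow> ch n (u + v) s = ch n u s * ch n v s"
  by (auto simp: ch_def torus_def power_int_add simp flip: prod.distrib intro!: prod.cong)

lemma ch_mult: "ch n u (\<lambda>i. s i * t i) = ch n u s * ch n u t"
  by (simp add: ch_def power_int_mult_distrib prod.distrib)

lemma ch_nonzero: "s \<in> torus n \<Longrightarrow> ch n u s \<noteq> 0"
  by (auto simp: ch_def torus_def)

lemma torus_mult: "s \<in> torus n \<Longrightarrow> t \<in> torus n \<Longrightarrow> (\<lambda>i. s i * t i) \<in> torus n"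
  by (auto simp: torus_def)

lemma alg_closed_infinite: "infinite (UNIV :: 'k::alg_closed_field set)"
proof
  assume fin: "finite (UNIV :: 'k set)"
  define p :: "'k poly" where "p = (\<Prod>a\<in>UNIV. [:-a, 1:]) + 1"
  have "poly p x = 1" for x
    unfolding p_def using fin by (simp add: poly_prod prod_zero_iff)
  moreover have "degree (\<Prod>a\<in>(UNIV :: 'k set). [:-a, 1:]) = card (UNIV :: 'k set)"
    by (subst degree_prod_eq_sum_degree) auto
  then have "degree p > 0"
    using fin unfolding p_def by (subst degree_add_eq_left) (auto simp: card_gt_0_iff)
  ultimately show False
    using alg_closed_imp_poly_has_root[of p] by auto
qed

text \<open>
  The weights in \<open>K\<close> restrict to distinct weights on the one-parameter subgroup
  \<open>z \<mapsto> (z, z\<^sup>a, z\<^sup>a\<^sup>a, \<dots>)\<close>.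
\<close>

lemma separating_one_parameter:
  assumes "finite K" "K \<subseteq> weights n"
  shows "\<exists>a::int. inj_on (\<lambda>u. \<Sum>i<n. u i * a ^ i) K"
proof -
  define P where "P = (\<lambda>(u, v). \<Sum>i<n. monom (u i - v i :: int) i)"
  \<comment> \<open>Weights \<open>u\<close> and \<open>v\<close> agree on the subgroup with
    exponents \<open>a ^ i\<close> iff \<open>a\<close> is a root of \<open>P (u, v)\<close>;
    finitely many nonzero polynomials leave a good integer \<open>a\<close>.\<close>
  define B where "B = (\<Union>p\<in>{p \<in> K \<times> K. fst p \<noteq> snd p}. {a. poly (P p) a = 0})"
  have "P (u, v) \<noteq> 0" if uv: "u \<in> K" "v \<in> K" "u \<noteq> v" for u v
  proof
    assume 0: "P (u, v) = 0"
    have "u i = v i" for i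
    proof (cases "i < n")
      case True
      have "coeff (P (u, v)) i = u i - v i"
        using True by (simp add: P_def coeff_sum if_distrib[of "\<lambda>x. x = _"] sum.If_cases
            cong: if_cong)
      with 0 show ?thesis by simp
    qed (use subsetD[OF assms(2) uv(1)] subsetD[OF assms(2) uv(2)] in \<open>simp add: weights_def\<close>)
    with uv(3) show False by auto
  qed
  then have "finite B"
    unfolding B_def using assms(1) by (intro finite_UN_I) (auto intro: poly_roots_finite)
  then obtain a where "a \<notin> B"
    using infinite_UNIV_int by (meson ex_new_if_finite)
  then have "inj_on (\<lambda>u. \<Sum>i<n. u i * a ^ i) K"
    unfolding inj_on_def B_def P_def
    by (auto simp: poly_sum poly_monom algebra_simps sum_subtractf)
  then show ?thesis ..
qed

lemma finite_laurent_roots: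
  fixes c :: "int \<Rightarrow> 'k::field"
  assumes "finite K" "j \<in> K" "c j \<noteq> 0"
  shows "finite {z. z \<noteq> 0 \<and> (\<Sum>j\<in>K. c j * z powi j) = 0}"
proof -
  obtain M where M: "\<And>j. j \<in> K \<Longrightarrow> \<bar>j\<bar> \<le> M"
    using assms(1) by (metis (no_types, lifting) Max_ge finite_imageI imageI)
  \<comment> \<open>Multiplication by \<open>z powi M\<close> clears the negative exponents.\<close>
  define p where "p = (\<Sum>j\<in>K. monom (c j) (nat (j + M)))"
  have "coeff p (nat (j + M)) = (\<Sum>i\<in>K. if i = j then c j else 0)"
    unfolding p_def coeff_sum coeff_monom
  proof (intro sum.cong refl)
    fix i assume "i \<in> K"
    then show "(if nat (i + M) = nat (j + M) then c i else 0) = (if i = j then c j else 0)"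
      using M[of i] M[OF assms(2)] by (auto simp: nat_eq_iff)
  qed
  then have "p \<noteq> 0"
    using assms by (auto simp: sum.delta)
  moreover have "poly p z = z powi M * (\<Sum>j\<in>K. c j * z powi j)" if "z \<noteq> 0" for z
  proof -
    have "z ^ nat (j + M) = z powi M * z powi j" if "j \<in> K" for j
    proof -
      have "z ^ nat (j + M) = z powi (j + M)"
        using M[OF that] by (simp add: power_int_def)
      then show ?thesis
        using \<open>z \<noteq> 0\<close> by (simp add: power_int_add mult.commute)
    qed
    then show ?thesis
      unfolding p_def sum_distrib_left by (auto simp: poly_sum poly_monom intro!: sum.cong)
  qed
  ultimately show ?thesis
    by (intro finite_subset[OF _ poly_roots_finite[of p]]) auto
qed

text \<open>Restricted to a one-parameter subgroup that separates all exponents of both sums, each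
  becomes a nonzero Laurent polynomial in one variable, with finitely many roots in an infinite
  field. A common point for both sums is what irreducibility of orbits asks for.\<close>

lemma two_laurent_nonzero:
  fixes c d :: "(nat \<Rightarrow> int) \<Rightarrow> 'k::alg_closed_field"
  assumes K: "finite K" "K \<subseteq> weights n" "u \<in> K" "c u \<noteq> 0"
    and L: "finite L" "L \<subseteq> weights n" "v \<in> L" "d v \<noteq> 0"
  shows "\<exists>s\<in>torus n. (\<Sum>u\<in>K. c u * ch n u s) \<noteq> 0 \<and> (\<Sum>u\<in>L. d u * ch n u s) \<noteq> 0"
proof -
  obtain a :: int where a: "inj_on (\<lambda>u. \<Sum>i<n. u i * a ^ i) (K \<union> L)"
    using separating_one_parameter[of "K \<union> L" n] K L by auto
  let ?l = "\<lambda>u. \<Sum>i<n. u i * a ^ i"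
  define s where "s z i = z powi (a ^ i)" for z :: 'k and i :: nat
  have s: "s z \<in> torus n" if "z \<noteq> 0" for z
    using that by (auto simp: s_def torus_def)
  have ch: "ch n u (s z) = z powi ?l u" if "z \<noteq> 0" for u z
    using that unfolding ch_def s_def
    by (induction n) (simp_all add: power_int_add mult.commute flip: power_int_mult)
  have fin: "finite {z. z \<noteq> 0 \<and> (\<Sum>u\<in>H. b u * ch n u (s z)) = 0}"
    if H: "finite H" "H \<subseteq> K \<union> L" "w \<in> H" "b w \<noteq> 0" for H w and b :: "(nat \<Rightarrow> int) \<Rightarrow> 'k"
  proof -
    have inj: "inj_on ?l H"
      using a H(2) by (rule inj_on_subset)
    define b' where "b' j = b (the_inv_into H ?l j)" for j
    have b': "b' (?l u) = b u" if "u \<in> H" for u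
      unfolding b'_def by (simp only: the_inv_into_f_f[OF inj that])
    have "(\<Sum>u\<in>H. b u * ch n u (s z)) = (\<Sum>j\<in>?l ` H. b' j * z powi j)" if "z \<noteq> 0" for z
      unfolding sum.reindex[OF inj] using b' ch[OF that] by simp
    then have "{z. z \<noteq> 0 \<and> (\<Sum>u\<in>H. b u * ch n u (s z)) = 0}
        = {z. z \<noteq> 0 \<and> (\<Sum>j\<in>?l ` H. b' j * z powi j) = 0}"
      by auto
    then show ?thesis
      using finite_laurent_roots[of "?l ` H" "?l w" b'] H b' by auto
  qed
  have "finite ({0} \<union> {z. z \<noteq> 0 \<and> (\<Sum>u\<in>K. c u * ch n u (s z)) = 0}
      \<union> {z. z \<noteq> 0 \<and> (\<Sum>u\<in>L. d u * ch n u (s z)) = 0})"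
    using fin[of K u c] fin[of L v d] K L by simp
  then obtain z where "z \<notin> {0} \<union> {z. z \<noteq> 0 \<and> (\<Sum>u\<in>K. c u * ch n u (s z)) = 0}
      \<union> {z. z \<noteq> 0 \<and> (\<Sum>u\<in>L. d u * ch n u (s z)) = 0}"
    using alg_closed_infinite by (meson ex_new_if_finite)
  then show ?thesis
    using s by (intro bexI[of _ "s z"]) auto
qed

lemma ch_independent:
  fixes c :: "(nat \<Rightarrow> int) \<Rightarrow> 'k::alg_closed_field"
  assumes "finite K" "K \<subseteq> weights n" "\<And>s. s \<in> torus n \<Longrightarrow> (\<Sum>u\<in>K. c u * ch n u s) = 0" "u \<in> K"
  shows "c u = 0"
  using two_laurent_nonzero[of K n u c K u c] assms by metis


section \<open>Submonoids of the weight lattice\<close>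

inductive_set mon_hull :: "'a::monoid_add set \<Rightarrow> 'a set" for W where
  zero: "0 \<in> mon_hull W"
| step: "u \<in> W \<Longrightarrow> v \<in> mon_hull W \<Longrightarrow> u + v \<in> mon_hull W"

lemma mon_base: "u \<in> W \<Longrightarrow> u \<in> mon_hull W"
  using mon_hull.step[OF _ mon_hull.zero] by fastforce

lemma mon_add: "u \<in> mon_hull W \<Longrightarrow> v \<in> mon_hull W \<Longrightarrow> u + v \<in> mon_hull W"
  by (induction rule: mon_hull.induct) (auto simp: add.assoc intro: mon_hull.step)

lemma mon_least:
  assumes "W \<subseteq> L" "0 \<in> L" "\<And>u v. u \<in> L \<Longrightarrow> v \<in> L \<Longrightarrow> u + v \<in> L"
  shows "mon_hull W \<subseteq> L"
proof
  fix u assume "u \<in> mon_hull W"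
  then show "u \<in> L" by induction (use assms in auto)
qed

lemma mon_mono: "U \<subseteq> W \<Longrightarrow> mon_hull U \<subseteq> mon_hull W"
  by (intro mon_least) (auto intro: mon_base mon_hull.zero mon_add)

lemma mon_weights: "W \<subseteq> weights n \<Longrightarrow> mon_hull W \<subseteq> weights n"
  by (intro mon_least) (auto intro: weights_0 weights_add)

lemma mon_minus:
  fixes W :: "'a::ab_group_add set"
  assumes "\<And>w. w \<in> W \<Longrightarrow> - w \<in> mon_hull W" "u \<in> mon_hull W"
  shows "- u \<in> mon_hull W"
  using assms(2)
proof induction
  case (step u v)
  then show ?case
    using mon_add[OF assms(1)[OF step.hyps(1)] step.IH] by simp
qed (simp add: mon_hull.zero)

definition smul :: "int \<Rightarrow> (nat \<Rightarrow> int) \<Rightarrow> nat \<Rightarrow> int" where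
  "smul c u = (\<lambda>i. c * u i)"

lemma smul_apply: "smul c u i = c * u i"
  by (simp add: smul_def)

definition comb :: "(nat \<Rightarrow> int) set \<Rightarrow> ((nat \<Rightarrow> int) \<Rightarrow> int) \<Rightarrow> nat \<Rightarrow> int" where
  "comb V m = (\<lambda>i. \<Sum>v\<in>V. m v * v i)"

lemma mon_smul:
  assumes "u \<in> mon_hull W" "c \<ge> 0"
  shows "smul c u \<in> mon_hull W"
  using assms(2)
proof (induction c rule: int_ge_induct)
  case base
  have "smul 0 u = 0" by (rule ext) (simp add: smul_apply)
  then show ?case using mon_hull.zero by metis
next
  case (step c)
  have "smul (c + 1) u = u + smul c u" by (rule ext) (simp add: smul_apply algebra_simps)
  then show ?case using mon_add[OF assms(1) step.IH] by metis
qed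

lemma comb_insert: "finite V \<Longrightarrow> v \<notin> V \<Longrightarrow> comb (insert v V) m = smul (m v) v + comb V m"
  by (rule ext) (simp add: comb_def smul_apply)

lemma comb_in_mon:
  assumes "finite V" "V \<subseteq> W" "\<And>v. v \<in> V \<Longrightarrow> 0 \<le> m v"
  shows "comb V m \<in> mon_hull W"
  using assms
proof (induction V)
  case empty
  have "comb {} m = 0" by (auto simp: comb_def)
  then show ?case using mon_hull.zero by metis
next
  case (insert v V)
  then show ?case
    unfolding comb_insert[OF insert.hyps] by (intro mon_add mon_smul) (auto intro: mon_base)
qed

lemma mon_imp_comb:
  assumes "finite W" "u \<in> mon_hull W"
  shows "\<exists>m. (\<forall>v. 0 \<le> m v) \<and> u = comb W m"
  using assms(2)
proof induction
  case zero
  show ?case by (intro exI[of _ "\<lambda>_. 0"]) (auto simp: comb_def)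
next
  case (step w v)
  then obtain m where m: "\<forall>v. 0 \<le> m v" "v = comb W m" by blast
  have "w + v = comb W (\<lambda>v. (if v = w then 1 else 0) + m v)"
    using assms(1) step.hyps m(2)
    by (auto simp: comb_def distrib_right sum.distrib if_distrib[of "\<lambda>x. x * _"] sum.delta' cong: if_cong)
  then show ?case using m(1)
    by (intro exI[of _ "\<lambda>v. (if v = w then 1 else 0) + m v"]) auto
qed

section \<open>Leading indices and the growth of a lattice\<close>

text \<open>These are the pivot positions of an echelon form; for a subgroup of the weight lattice
  their number is its rank.\<close>

definition leading :: "(nat \<Rightarrow> int) set \<Rightarrow> nat set" where
  "leading L = {j. \<exists>u\<in>L. u j \<noteq> 0 \<and> (\<forall>i>j. u i = 0)}"

lemma leading_weights: "L \<subseteq> weights n \<Longrightarrow> leading L \<subseteq> {..<n}"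
  unfolding leading_def weights_def by (auto simp: subset_iff) (meson not_less)

lemma finite_leading: "L \<subseteq> weights n \<Longrightarrow> finite (leading L)"
  by (rule finite_subset[OF leading_weights finite_lessThan])

lemma exists_leading_index:
  assumes "u \<in> weights n" "u \<noteq> 0"
  shows "\<exists>j. u j \<noteq> 0 \<and> (\<forall>i>j. u i = 0)"
proof -
  let ?S = "{i. u i \<noteq> 0}"
  have "i < n" if "u i \<noteq> 0" for i
    using assms(1) that unfolding weights_def by (cases "i < n") auto
  then have fin: "finite ?S"
    by (intro finite_subset[OF _ finite_lessThan[of n]]) auto
  have "?S \<noteq> {}" using assms(2) by auto
  then have "u (Max ?S) \<noteq> 0" using Max_in[OF fin] by blast
  moreover have "u i = 0" if "i > Max ?S" for i
    using that Max_ge[OF fin, of i] by fastforce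
  ultimately show ?thesis by blast
qed

text \<open>A nonzero difference of two elements of \<open>L\<close> has its last nonzero entry at a
  position in \<open>leading L\<close>, so an element is determined by its entries at these
  positions.\<close>

lemma card_box:
  assumes L: "L \<subseteq> weights n" "\<And>u v. u \<in> L \<Longrightarrow> v \<in> L \<Longrightarrow> u - v \<in> L"
  shows "finite {u \<in> L. \<forall>i. \<bar>u i\<bar> \<le> int b}" (is "finite ?B")
    and "card {u \<in> L. \<forall>i. \<bar>u i\<bar> \<le> int b} \<le> (2 * b + 1) ^ card (leading L)"
proof -
  let ?P = "leading L \<rightarrow>\<^sub>E {- int b..int b}"
  have inj: "inj_on (\<lambda>u. restrict u (leading L)) ?B"
  proof (rule inj_onI, rule ccontr)
    fix u v assume *: "u \<in> ?B" "v \<in> ?B" "restrict u (leading L) = restrict v (leading L)" "u \<noteq> v"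
    then have "u - v \<in> L" "u - v \<noteq> 0" using L(2) by auto
    then obtain j where j: "(u - v) j \<noteq> 0" "\<forall>i>j. (u - v) i = 0"
      using exists_leading_index L(1) by blast
    then have "j \<in> leading L" unfolding leading_def using \<open>u - v \<in> L\<close> by blast
    then have "u j = v j" using *(3) by (metis restrict_apply')
    then show False using j(1) by simp
  qed
  have fin: "finite (leading L)" by (rule finite_leading[OF L(1)])
  have sub: "(\<lambda>u. restrict u (leading L)) ` ?B \<subseteq> ?P" by (auto simp: abs_le_iff minus_le_iff)
  have finP: "finite ?P" using fin by (intro finite_PiE) auto
  show "finite ?B" using finite_subset[OF sub finP] inj by (rule finite_imageD)
  have "card ?B \<le> card ?P"
    using card_inj_on_le[OF inj sub finP] .
  also have "card ?P = (2 * b + 1) ^ card (leading L)"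
    using fin by (simp add: card_PiE nat_add_distrib nat_mult_distrib)
  finally show "card ?B \<le> (2 * b + 1) ^ card (leading L)" .
qed

lemma growth_bound:
  fixes c d r :: nat
  assumes "\<And>m. (m + 1) ^ d \<le> (2 * (c * m) + 1) ^ r"
  shows "d \<le> r"
proof (rule ccontr)
  assume "\<not> d \<le> r"
  \<comment> \<open>Large enough for one more factor \<open>m + 1\<close> on the left to beat the
    constant \<open>(2 * c + 1) ^ r\<close> on the right.\<close>
  define m where "m = (2 * c + 1) ^ r"
  have "(m + 1) * (m + 1) ^ r \<le> (m + 1) ^ d"
    using \<open>\<not> d \<le> r\<close> power_increasing[of "Suc r" d "m + 1"] by simp
  also have "\<dots> \<le> (2 * (c * m) + 1) ^ r" by (rule assms)
  also have "\<dots> \<le> ((2 * c + 1) * (m + 1)) ^ r"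
    by (intro power_mono) (auto simp: algebra_simps)
  also have "\<dots> = m * (m + 1) ^ r" unfolding power_mult_distrib by (simp only: m_def)
  finally show False by simp
qed

definition indep :: "(nat \<Rightarrow> int) set \<Rightarrow> bool" where
  "indep V \<longleftrightarrow> (\<forall>m. comb V m = 0 \<longrightarrow> (\<forall>v\<in>V. m v = 0))"

text \<open>Combinations of an independent \<open>C\<close> with coefficients from \<open>0\<close>
  to \<open>m\<close> are pairwise distinct, giving \<open>(m + 1) ^ card C\<close> weights in a box
  whose side grows linearly in \<open>m\<close>; such a box holds only on the order of
  \<open>m ^ n\<close> weights.\<close>

lemma indep_card:
  assumes C: "finite C" "C \<subseteq> weights n" "indep C"
  shows "card C \<le> n"
proof -
  have fin: "finite ((\<lambda>(v, i). nat \<bar>v i\<bar>) ` (C \<times> {..<n}))" using C(1) by simp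
  obtain b where "\<forall>k\<in>(\<lambda>(v, i). nat \<bar>v i\<bar>) ` (C \<times> {..<n}). k \<le> b"
    using finite_nat_set_iff_bounded_le[THEN iffD1, OF fin] by blast
  then have b: "nat \<bar>v i\<bar> \<le> b" if "v \<in> C" "i < n" for v i
    using that by fastforce
  have b': "\<bar>v i\<bar> \<le> int b" if "v \<in> C" for v i
    using b[OF that, of i] C(2) that by (cases "i < n") (auto simp: weights_def subset_iff)
  let ?W = "weights n"
  have diff: "u - v \<in> ?W" if "u \<in> ?W" "v \<in> ?W" for u v :: "nat \<Rightarrow> int"
    using that by (auto simp: weights_def)
  have "(m + 1) ^ card C \<le> (2 * ((card C * b) * m) + 1) ^ card (leading ?W)" for m
  proof -
    let ?P = "C \<rightarrow>\<^sub>E {0..int m}"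
    let ?B = "{u \<in> ?W. \<forall>i. \<bar>u i\<bar> \<le> int (card C * b * m)}"
    have inj: "inj_on (comb C) ?P"
    proof (rule inj_onI)
      fix f g assume *: "f \<in> ?P" "g \<in> ?P" "comb C f = comb C g"
      then have "comb C (\<lambda>v. f v - g v) = 0"
        by (auto simp: comb_def left_diff_distrib sum_subtractf fun_eq_iff)
      then have "\<forall>v\<in>C. f v = g v" using C(3) unfolding indep_def by auto
      then show "f = g" using * by (intro PiE_ext) auto
    qed
    have sub: "comb C ` ?P \<subseteq> ?B"
    proof safe
      fix f assume f: "f \<in> ?P"
      show "comb C f \<in> ?W"
        using C(2) unfolding comb_def weights_def by (auto intro!: sum.neutral)
      fix i
      have "\<bar>comb C f i\<bar> \<le> (\<Sum>v\<in>C. \<bar>f v * v i\<bar>)" unfolding comb_def by (rule sum_abs)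
      also have "\<dots> \<le> (\<Sum>v\<in>C. int m * int b)"
      proof (rule sum_mono)
        fix v assume v: "v \<in> C"
        then have "\<bar>f v\<bar> \<le> int m" using f by (auto simp: PiE_def Pi_def)
        then show "\<bar>f v * v i\<bar> \<le> int m * int b"
          unfolding abs_mult using b'[OF v, of i] by (intro mult_mono) auto
      qed
      finally show "\<bar>comb C f i\<bar> \<le> int (card C * b * m)" by (simp add: mult_ac)
    qed
    have "(m + 1) ^ card C = card ?P" using C(1) by (simp add: card_PiE nat_add_distrib nat_mult_distrib)
    also have "\<dots> \<le> card ?B"
      by (rule card_inj_on_le[OF inj sub]) (rule card_box(1)[OF order_refl diff])
    also have "\<dots> \<le> (2 * (card C * b * m) + 1) ^ card (leading ?W)"
      by (rule card_box(2)[OF order_refl diff])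
    finally show ?thesis .
  qed
  then have "card C \<le> card (leading ?W)" by (rule growth_bound)
  also have "\<dots> \<le> n"
    using card_mono[OF _ leading_weights[OF order_refl, of n]] by simp
  finally show ?thesis .
qed

section \<open>Positively spanning sets of weights\<close>

text \<open>Caratheodory's argument: a shortest positive combination has independent support.\<close>

lemma caratheodory:
  assumes W: "finite W" and x: "x \<in> mon_hull W"
  shows "\<exists>C\<subseteq>W. indep C \<and> (\<exists>N>0. \<exists>m. (\<forall>v\<in>C. 0 < m v) \<and> smul N x = comb C m)"
proof -
  \<comment> \<open>Coefficients stay integral; the multiple \<open>N\<close> of \<open>x\<close>
    replaces division.\<close>
  define Q where "Q C \<longleftrightarrow> C \<subseteq> W \<and> (\<exists>N>0. \<exists>m. (\<forall>v\<in>C. 0 < m v) \<and> smul N x = comb C m)" for C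
  have supp: "Q {v \<in> C. 0 < m v}"
    if "C \<subseteq> W" "\<And>v. v \<in> C \<Longrightarrow> 0 \<le> m v" "smul N x = comb C m" "N > 0" for C m N
  proof -
    have "comb C m = comb {v \<in> C. 0 < m v} m"
      unfolding comb_def using that(2) finite_subset[OF that(1) W]
      by (intro ext sum.mono_neutral_right) (force simp: order_le_less)+
    then show ?thesis unfolding Q_def using that by auto
  qed
  obtain m where m: "\<forall>v. 0 \<le> m v" "x = comb W m" using mon_imp_comb[OF W x] by blast
  have "smul 1 x = x" by (rule ext) (simp add: smul_apply)
  then have "smul 1 x = comb W m" using m(2) by (rule trans)
  then have "Q {v \<in> W. 0 < m v}" using supp[of W m 1] m(1) by auto
  then obtain C where C: "Q C" "\<And>C'. Q C' \<Longrightarrow> card C \<le> card C'"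
    using ex_has_least_nat[of Q _ card] by blast
  then obtain N m where N: "N > 0" "\<forall>v\<in>C. 0 < m v" "smul N x = comb C m" and CW: "C \<subseteq> W"
    unfolding Q_def by blast
  have fC: "finite C" using CW W finite_subset by blast
  have False if d: "comb C d = 0" "v0 \<in> C" "0 < d v0" for d v0
  proof -
    let ?D = "{v \<in> C. 0 < d v}"
    have "finite ?D" "?D \<noteq> {}" using fC d by auto
    \<comment> \<open>Ratio test: moving along the relation \<open>d\<close>, the coefficient at
      \<open>c\<close> is the first to reach zero, so that \<open>m'\<close> below is nonnegative on
      \<open>C\<close> and vanishes at \<open>c\<close>.\<close>
    then obtain c where c: "c \<in> ?D" "\<And>v. v \<in> ?D \<Longrightarrow> rat_of_int (m c) / of_int (d c) \<le> of_int (m v) / of_int (d v)"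
      using ex_is_arg_min_if_finite[of ?D "\<lambda>v. rat_of_int (m v) / of_int (d v)"]
      unfolding is_arg_min_linorder by blast
    define m' where "m' v = d c * m v - m c * d v" for v
    have "0 \<le> m' v" if v: "v \<in> C" for v
    proof (cases "0 < d v")
      case True
      then have "rat_of_int (m c * d v) \<le> rat_of_int (m v * d c)"
        using c(1) c(2)[of v] v by (auto simp: field_simps)
      then show ?thesis unfolding m'_def of_int_le_iff by (simp add: mult.commute)
    next
      case False
      then have "m c * d v \<le> 0" "0 \<le> d c * m v"
        using c(1) N(2) v by (auto simp: mult_le_0_iff order.strict_implies_order)
      then show ?thesis unfolding m'_def by linarith
    qed
    moreover have "smul (d c * N) x = comb C m'"
    proof
      fix i
      have "(\<Sum>v\<in>C. d v * v i) = 0" using fun_cong[OF d(1), of i] by (simp add: comb_def)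
      moreover have "N * x i = (\<Sum>v\<in>C. m v * v i)"
        using fun_cong[OF N(3), of i] by (simp add: comb_def smul_apply)
      moreover have "comb C m' i = d c * (\<Sum>v\<in>C. m v * v i) - m c * (\<Sum>v\<in>C. d v * v i)"
        unfolding comb_def m'_def sum_distrib_left sum_subtractf[symmetric]
        by (intro sum.cong) (auto simp: algebra_simps)
      ultimately show "smul (d c * N) x i = comb C m' i" by (simp add: smul_apply mult.assoc)
    qed
    ultimately have "Q {v \<in> C. 0 < m' v}" using supp[of C m' "d c * N"] CW c(1) N(1) by auto
    moreover have "m' c = 0" by (simp add: m'_def)
    then have "c \<notin> {v \<in> C. 0 < m' v}" by simp
    then have "{v \<in> C. 0 < m' v} \<subset> C" using c(1) by blast
    ultimately show False using C(2) psubset_card_mono[OF fC] by (meson not_le)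
  qed
  note pos = this
  have "indep C" unfolding indep_def
  proof (intro allI impI ballI, rule ccontr)
    fix d v assume d: "comb C d = 0" "v \<in> C" "d v \<noteq> 0"
    \<comment> \<open>The exchange needs a positive coefficient; the relation or its negative has
      one at \<open>v\<close>.\<close>
    have "comb C (\<lambda>v. - d v) = 0"
      using d(1) by (auto simp: comb_def sum_negf fun_eq_iff)
    then show False using pos[of d v] pos[of "\<lambda>v. - d v" v] d by force
  qed
  then show ?thesis using CW N by blast
qed

text \<open>
  Steinitz: take a maximal independent set \<open>B\<close> of weights, and complete it by the support of a
  shortest positive combination equal to a multiple of \<open>- \<Sum>B\<close>.
\<close>

lemma steinitz:
  assumes W: "finite W" "W \<subseteq> weights n" "\<And>w. w \<in> W \<Longrightarrow> - w \<in> mon_hull W"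
  shows "\<exists>V\<subseteq>W. card V \<le> 2 * n \<and> (\<forall>U. V \<subseteq> U \<longrightarrow> U \<subseteq> W \<longrightarrow>
     (\<forall>u\<in>U. - u \<in> mon_hull U) \<and> (\<forall>w\<in>W. \<exists>N>0. smul N w \<in> mon_hull U))"
proof -
  have "\<exists>B. (B \<subseteq> W \<and> indep B) \<and> (\<forall>B'. B' \<subseteq> W \<and> indep B' \<longrightarrow> card B' \<le> card B)"
    by (rule ex_has_greatest_nat[of _ "{}" _ "Suc (card W)"])
      (use W(1) in \<open>auto simp: indep_def less_Suc_eq_le intro: card_mono\<close>)
  then obtain B where B: "B \<subseteq> W" "indep B" "\<And>B'. B' \<subseteq> W \<Longrightarrow> indep B' \<Longrightarrow> card B' \<le> card B"
    by blast
  have fB: "finite B" using B(1) W(1) finite_subset by blast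
  define b where "b = comb B (\<lambda>_. 1)"
  have "b \<in> mon_hull W"
    unfolding b_def by (rule comb_in_mon[OF fB B(1)]) simp
  then have "- b \<in> mon_hull W"
    using mon_minus[of W b] W(3) by blast
  from caratheodory[OF W(1) this] obtain C N m where C: "C \<subseteq> W" "indep C" and N: "N > 0"
    "\<forall>v\<in>C. 0 < m v" "smul N (- b) = comb C m"
    by blast
  have fC: "finite C" using C(1) W(1) finite_subset by blast
  let ?V = "B \<union> C"
  have VW: "?V \<subseteq> W" and fV: "finite ?V" using B C fB fC by auto
  have "card B \<le> n" "card C \<le> n" using indep_card B C W(2) fB fC by blast+
  then have "card ?V \<le> 2 * n" using card_Un_le[of B C] by linarith
  \<comment> \<open>Since the combination over \<open>C\<close> is \<open>-N\<close> times the sum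
    of \<open>B\<close>, adding \<open>N\<close> times that sum gives a relation on all of
    \<open>?V\<close> with coefficients at least \<open>1\<close>.\<close>
  define p where "p v = (if v \<in> B then N else 0) + (if v \<in> C then m v else 0)" for v
  have "comb ?V p = 0"
  proof
    fix i
    have "comb ?V p i = (\<Sum>v\<in>?V. if v \<in> B then N * v i else 0) + (\<Sum>v\<in>?V. if v \<in> C then m v * v i else 0)"
      unfolding comb_def p_def sum.distrib[symmetric] by (intro sum.cong) (auto simp: algebra_simps)
    also have "\<dots> = (\<Sum>v\<in>B. N * v i) + (\<Sum>v\<in>C. m v * v i)"
      using fB fC by (simp add: sum.If_cases Int_absorb1)
    also have "\<dots> = 0"
      using fun_cong[OF N(3), of i] by (simp add: b_def comb_def smul_apply flip: sum_distrib_left)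
    finally show "comb ?V p i = 0 i" by simp
  qed
  have p_pos: "p v \<ge> 1" if "v \<in> ?V" for v using that N by (force simp: p_def)
  have negV: "- v \<in> mon_hull ?V" if v: "v \<in> ?V" for v
  proof -
    have "- v = comb ?V (\<lambda>w. p w - (if w = v then 1 else 0))"
    proof
      fix i
      have "comb ?V (\<lambda>w. p w - (if w = v then 1 else 0)) i
          = comb ?V p i - (\<Sum>w\<in>?V. (if w = v then 1 else 0) * w i)"
        unfolding comb_def by (simp add: left_diff_distrib sum_subtractf)
      then show "(- v) i = comb ?V (\<lambda>w. p w - (if w = v then 1 else 0)) i"
        using \<open>comb ?V p = 0\<close> fV v
        by (simp add: if_distrib[of "\<lambda>x. x * _"] sum.delta' sum.delta cong: if_cong)
    qed
    then show ?thesis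
      using comb_in_mon[OF fV order_refl, of "\<lambda>w. p w - (if w = v then 1 else 0)"] p_pos by force
  qed
  have spanV: "\<exists>N>0. smul N w \<in> mon_hull ?V" if w: "w \<in> W" for w
  proof (cases "w \<in> B")
    case True
    have "smul 1 w = w" by (rule ext) (simp add: smul_apply)
    then show ?thesis using True by (intro exI[of _ 1]) (auto intro: mon_base)
  next
    case False
    then have "card (insert w B) > card B" using fB by simp
    \<comment> \<open>By maximality of \<open>B\<close> some nonzero multiple of \<open>w\<close> is
      an integral combination of \<open>B\<close>; negative coefficients are harmless because
      negatives of \<open>?V\<close> lie in its monoid.\<close>
    then have "\<not> indep (insert w B)" using B(1) B(3)[of "insert w B"] w by force
    then obtain d v where d: "comb (insert w B) d = 0" "v \<in> insert w B" "d v \<noteq> 0"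
      unfolding indep_def by blast
    have dw: "d w \<noteq> 0"
    proof
      assume "d w = 0"
      then have "comb B d = 0" using d(1) comb_insert[OF fB False, of d] by (auto simp: smul_apply fun_eq_iff)
      then show False using B(2) d \<open>d w = 0\<close> unfolding indep_def by auto
    qed
    have comb_neg: "comb B a \<in> mon_hull ?V" for a
    proof -
      have "comb F a \<in> mon_hull ?V" if "F \<subseteq> B" for F
        using finite_subset[OF that fB] that
      proof (induction F)
        case empty
        have "comb {} a = 0" by (auto simp: comb_def)
        then show ?case using mon_hull.zero by metis
      next
        case (insert v F)
        have "smul (a v) v \<in> mon_hull ?V"
        proof (cases "a v \<ge> 0")
          case False
          have "smul (a v) v = smul (- a v) (- v)" by (rule ext) (simp add: smul_apply)
          then show ?thesis using mon_smul[OF negV, of v "- a v"] False insert by simp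
        qed (use insert in \<open>auto intro: mon_smul mon_base\<close>)
        then show ?case unfolding comb_insert[OF insert.hyps(1,2)] using insert by (intro mon_add) auto
      qed
      then show ?thesis by blast
    qed
    have "smul (\<bar>d w\<bar>) w = comb B (\<lambda>v. - sgn (d w) * d v)"
    proof
      fix i
      have "d w * w i = - (\<Sum>v\<in>B. d v * v i)"
        using fun_cong[OF d(1), of i] unfolding comb_insert[OF fB False]
        by (simp add: comb_def smul_apply eq_neg_iff_add_eq_0)
      then have "sgn (d w) * (d w * w i) = - sgn (d w) * (\<Sum>v\<in>B. d v * v i)" by simp
      then show "smul (\<bar>d w\<bar>) w i = comb B (\<lambda>v. - sgn (d w) * d v) i"
        by (simp add: comb_def smul_apply sum_distrib_left sum_negf abs_sgn mult_ac)
    qed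
    then show ?thesis using comb_neg dw by (intro exI[of _ "\<bar>d w\<bar>"]) simp
  qed
  \<comment> \<open>Selecting whole factors adds weights beyond \<open>?V\<close>. A multiple
    \<open>N\<close> of such a weight is invertible already in the monoid of \<open>?V\<close>, and
    \<open>N - 1\<close> further copies of the weight turn the inverse of the multiple into the
    inverse of the weight.\<close>
  have neg: "- u \<in> mon_hull U" if U: "?V \<subseteq> U" "U \<subseteq> W" "u \<in> U" for u U
  proof -
    obtain N where N: "N > 0" "smul N u \<in> mon_hull ?V" using spanV U by blast
    have "- smul N u \<in> mon_hull ?V" using mon_minus[of ?V] negV N(2) by blast
    then have "- smul N u \<in> mon_hull U" using mon_mono[OF U(1)] by blast
    moreover have "smul (N - 1) u \<in> mon_hull U" using N(1) U(3) by (intro mon_smul mon_base) auto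
    moreover have "- u = - smul N u + smul (N - 1) u"
      by (rule ext) (simp add: smul_apply algebra_simps)
    ultimately show ?thesis using mon_add by metis
  qed
  have span: "\<exists>N>0. smul N w \<in> mon_hull U" if "?V \<subseteq> U" "w \<in> W" for w U
    using spanV[OF that(2)] mon_mono[OF that(1)] by blast
  show ?thesis
    by (intro exI[of _ ?V] conjI allI impI ballI VW \<open>card ?V \<le> 2 * n\<close> neg span)
qed

text \<open>A positive multiple has the same last nonzero entry, and reaching the generators up to
  multiples reaches the whole monoid up to multiples.\<close>

lemma leading_mon_cong:
  assumes "U \<subseteq> W" "\<And>w. w \<in> W \<Longrightarrow> \<exists>N>0. smul N w \<in> mon_hull U"
  shows "leading (mon_hull U) = leading (mon_hull W)"
proof
  show "leading (mon_hull U) \<subseteq> leading (mon_hull W)"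
    using mon_mono[OF assms(1)] unfolding leading_def by blast
  have *: "\<exists>N>0. smul N u \<in> mon_hull U" if "u \<in> mon_hull W" for u
    using that
  proof induction
    case zero
    have "smul 1 0 = 0" by (rule ext) (simp add: smul_apply)
    then show ?case using mon_hull.zero zero_less_one by metis
  next
    case (step w v)
    then obtain M N where MN: "M > 0" "smul M w \<in> mon_hull U" "N > 0" "smul N v \<in> mon_hull U"
      using assms(2) by blast
    have "smul (M * N) (w + v) = smul N (smul M w) + smul M (smul N v)"
      by (rule ext) (simp add: smul_apply algebra_simps)
    then have "smul (M * N) (w + v) \<in> mon_hull U"
      using mon_add[OF mon_smul[OF MN(2), of N] mon_smul[OF MN(4), of M]] MN(1,3) by simp
    then show ?case using MN(1,3) mult_pos_pos by blast
  qed
  show "leading (mon_hull W) \<subseteq> leading (mon_hull U)"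
  proof
    fix j assume "j \<in> leading (mon_hull W)"
    then obtain u where u: "u \<in> mon_hull W" "u j \<noteq> 0" "\<forall>i>j. u i = 0" unfolding leading_def by blast
    then obtain N where "N > 0" "smul N u \<in> mon_hull U" using * by blast
    then show "j \<in> leading (mon_hull U)" unfolding leading_def using u by (intro CollectI bexI[of _ "smul N u"]) (auto simp: smul_apply)
  qed
qed

section \<open>Extending characters of a sublattice\<close>

lemma hom_smul:
  fixes h :: "(nat \<Rightarrow> int) \<Rightarrow> 'k::field"
  assumes L: "0 \<in> L" "\<And>u v. u \<in> L \<Longrightarrow> v \<in> L \<Longrightarrow> u + v \<in> L" "\<And>u. u \<in> L \<Longrightarrow> - u \<in> L"
    and h: "\<And>u v. u \<in> L \<Longrightarrow> v \<in> L \<Longrightarrow> h (u + v) = h u * h v" "\<And>u. u \<in> L \<Longrightarrow> h u \<noteq> 0"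
    and u: "u \<in> L"
  shows "smul k u \<in> L \<and> h (smul k u) = h u powi k"
proof -
  have h0: "h 0 = 1" using h(1)[OF L(1) L(1)] h(2)[OF L(1)] by simp
  have pos: "smul k u \<in> L \<and> h (smul k u) = h u powi k" if "k \<ge> 0" "u \<in> L" for k u
    using that(1)
  proof (induction k rule: int_ge_induct)
    case base
    have "smul 0 u = 0" by (rule ext) (simp add: smul_apply)
    then show ?case using L(1) h0 by (metis power_int_0_right)
  next
    case (step k)
    have "smul (k + 1) u = u + smul k u" by (rule ext) (simp add: smul_apply algebra_simps)
    moreover have "h (u + smul k u) = h u powi (k + 1)"
      using h step.IH that(2) by (simp add: power_int_add_1')
    ultimately show ?case
      using L(2)[OF that(2)] step.IH by metis
  qed
  have neg: "h (- u) = inverse (h u)"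
  proof -
    have "h u * h (- u) = 1" using h(1)[OF u L(3)[OF u]] h0 by simp
    then show ?thesis by (simp add: inverse_unique)
  qed
  show ?thesis
  proof (cases "k \<ge> 0")
    case False
    have "smul k u = smul (- k) (- u)" by (rule ext) (simp add: smul_apply)
    moreover have "h (- u) powi (- k) = h u powi k"
      unfolding neg by (simp add: power_int_inverse power_int_minus)
    ultimately show ?thesis using pos[of "- k" "- u"] False L(3)[OF u] by simp
  qed (use pos u in blast)
qed

text \<open>The multiplicative group of an algebraically closed field is divisible, so homomorphisms
  into it extend from a subgroup to the whole weight lattice. The extension is made one coordinate
  at a time: \<open>s\<close> matches \<open>h\<close> on those elements of \<open>L\<close> that
  vanish from position \<open>j\<close> on.\<close>

lemma hom_extend:
  fixes h :: "(nat \<Rightarrow> int) \<Rightarrow> 'k::alg_closed_field"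
  assumes L: "L \<subseteq> weights n" "0 \<in> L" "\<And>u v. u \<in> L \<Longrightarrow> v \<in> L \<Longrightarrow> u + v \<in> L" "\<And>u. u \<in> L \<Longrightarrow> - u \<in> L"
    and h: "\<And>u v. u \<in> L \<Longrightarrow> v \<in> L \<Longrightarrow> h (u + v) = h u * h v" "\<And>u. u \<in> L \<Longrightarrow> h u \<noteq> 0"
  shows "\<exists>s\<in>torus n. \<forall>u\<in>L. ch n u s = h u"
proof -
  have h0: "h 0 = 1" using h(1)[OF L(2) L(2)] h(2)[OF L(2)] by simp
  have "\<exists>s. (\<forall>i. s i \<noteq> 0) \<and> (\<forall>u\<in>L. (\<forall>i\<ge>j. u i = 0) \<longrightarrow> (\<Prod>i<j. s i powi u i) = h u)" for j
  proof (induction j)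
    case 0
    have "h u = 1" if "\<forall>i\<ge>0. u i = 0" for u
    proof -
      have "u = 0" using that by auto
      with h0 show ?thesis by metis
    qed
    then show ?case by (intro exI[of _ "\<lambda>_. 1"]) auto
  next
    case (Suc j)
    then obtain s where s: "\<And>i. s i \<noteq> 0"
      "\<And>u. u \<in> L \<Longrightarrow> (\<And>i. i \<ge> j \<Longrightarrow> u i = 0) \<Longrightarrow> (\<Prod>i<j. s i powi u i) = h u"
      by blast
    let ?P = "\<lambda>u. \<Prod>i<j. s i powi u i"
    let ?L = "{u \<in> L. \<forall>i\<ge>Suc j. u i = 0}"
    show ?case
    proof (cases "\<forall>u\<in>?L. u j = 0")
      case True
      have "(\<Prod>i<Suc j. s i powi u i) = h u" if u: "u \<in> ?L" for u
      proof -
        have "u i = 0" if "i \<ge> j" for i using that u True by (cases "i = j") auto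
        then show ?thesis using s(2)[of u] u by simp
      qed
      then show ?thesis using s(1) by blast
    next
      case False
      then obtain u1 where u1: "u1 \<in> ?L" "u1 j \<noteq> 0" by blast
      \<comment> \<open>The \<open>j\<close>-th entries of this stage form a nonzero subgroup of the
        integers; an element \<open>v\<close> with least positive entry makes every division by
        \<open>v j\<close> exact.\<close>
      define Q where "Q u \<longleftrightarrow> u \<in> ?L \<and> u j > 0" for u
      have "- u1 \<in> ?L"
        using u1(1) L(4) by simp
      then have "Q (if u1 j > 0 then u1 else - u1)"
        using u1 by (simp add: Q_def)
      from ex_has_least_nat[of Q, OF this, of "\<lambda>u. nat (u j)"]
      obtain v where "Q v" and Q: "\<And>u. Q u \<Longrightarrow> nat (v j) \<le> nat (u j)"
        by blast
      then have v: "v \<in> ?L" "v j > 0"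
        and min: "\<And>u. u \<in> ?L \<Longrightarrow> u j > 0 \<Longrightarrow> nat (v j) \<le> nat (u j)"
        by (auto simp: Q_def)
      have Pv: "?P v \<noteq> 0" using s(1) by simp
      have "nat (v j) > 0" using v(2) by simp
      \<comment> \<open>The new coordinate \<open>z\<close> is prescribed by the value of
        \<open>h\<close> at \<open>v\<close> alone; the other elements of the stage differ from
        multiples of \<open>v\<close> by elements of the previous stage.\<close>
      from nth_root_exists[OF this, of "h v / ?P v"]
      obtain z where z: "z ^ nat (v j) = h v / ?P v" by blast
      then have z': "z powi v j * ?P v = h v" using v(2) Pv by (simp add: power_int_def)
      have "z \<noteq> 0"
      proof
        assume "z = 0"
        then show False using z' h(2)[of v] v by simp
      qed
      have "(\<Prod>i<Suc j. (s(j := z)) i powi u i) = h u" if u: "u \<in> ?L" for u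
      proof -
        define k where "k = u j div v j"
        have hk: "smul k v \<in> L" "h (smul k v) = h v powi k" "- smul k v \<in> L"
          using hom_smul[where L = L and h = h and k = k, OF L(2-4) h] L(4) v by auto
        define w where "w = u + - smul k v"
        have w: "w \<in> ?L" unfolding w_def using u v L(3)[OF _ hk(3)] by (auto simp: smul_apply)
        have wj: "w j = u j mod v j"
          by (simp add: w_def k_def smul_apply minus_mult_div_eq_mod mult.commute)
        have "w j = 0"
        proof (rule ccontr)
          assume "w j \<noteq> 0"
          moreover have "0 \<le> w j" "w j < v j" using wj v(2) by auto
          ultimately show False using min[OF w] by force
        qed
        have "w i = 0" if "i \<ge> j" for i using that w \<open>w j = 0\<close> by (cases "i = j") auto
        then have "?P w = h w" using s(2) w by blast
        have u_eq: "u = w + smul k v" by (simp add: w_def)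
        have "u j = k * v j" using \<open>w j = 0\<close> by (subst u_eq) (simp add: smul_apply)
        have "h u = h w * h v powi k" using h(1)[of w "smul k v"] w hk u_eq by simp
        also have "\<dots> = ?P w * (z powi v j * ?P v) powi k" using \<open>?P w = h w\<close> z' by simp
        also have "\<dots> = z powi (v j * k) * (?P w * ?P v powi k)"
          unfolding power_int_mult_distrib power_int_mult by (simp only: mult_ac)
        also have "?P w * ?P v powi k = (\<Prod>i<j. s i powi w i * (s i powi v i) powi k)"
          by (induction j) (simp_all add: power_int_mult_distrib mult_ac)
        also have "\<dots> = ?P u"
        proof (rule prod.cong)
          fix i
          have "u i = w i + v i * k" by (subst u_eq) (simp add: smul_apply)
          then show "s i powi w i * (s i powi v i) powi k = s i powi u i"
            by (simp add: power_int_add s(1) power_int_mult)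
        qed simp
        finally show ?thesis using \<open>u j = k * v j\<close> by (simp add: mult.commute)
      qed
      then show ?thesis using s(1) \<open>z \<noteq> 0\<close> by (intro exI[of _ "s(j := z)"]) auto
    qed
  qed
  from this[of n] obtain s where "\<And>i. s i \<noteq> 0"
    "\<And>u. u \<in> L \<Longrightarrow> (\<And>i. i \<ge> n \<Longrightarrow> u i = 0) \<Longrightarrow> (\<Prod>i<n. s i powi u i) = h u"
    by blast
  then show ?thesis using L(1)
    by (intro bexI[of _ s]) (auto simp: torus_def ch_def weights_def subset_iff)
qed


section \<open>Orbit maps of the torus\<close>

text \<open>
  Resolution may eta-expand a weight \<open>u + v\<close> to \<open>\<lambda>i. (u + v) i\<close>, which these rules would then
  turn into \<open>\<lambda>i. u i + v i\<close>.
\<close>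

declare plus_fun_apply [simp del] zero_fun_apply [simp del] uminus_apply [simp del] minus_apply [simp del]

text \<open>Abstracts an orbit map: coordinates are combinations of the characters in
  \<open>W\<close>, each of these characters is polynomial on the image, and coordinates separate
  points. No group action is mentioned, so the restriction to a coordinate subtorus is again an
  instance.\<close>

locale toric_map =
  fixes n :: nat and S :: "'p set" and C :: "('p \<Rightarrow> 'k::alg_closed_field) set"
    and f :: "(nat \<Rightarrow> 'k) \<Rightarrow> 'p" and W :: "(nat \<Rightarrow> int) set"
  assumes maps: "s \<in> torus n \<Longrightarrow> f s \<in> S"
    and finite_W: "finite W" and W_weights: "W \<subseteq> weights n"
    and coord: "g \<in> C \<Longrightarrow> \<exists>c. \<forall>s\<in>torus n. g (f s) = (\<Sum>w\<in>W. c w * ch n w s)"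
    and weight: "w \<in> W \<Longrightarrow> \<exists>q\<in>poly_funs C. \<forall>s\<in>torus n. q (f s) = ch n w s"
    and separated: "x \<in> S \<Longrightarrow> y \<in> S \<Longrightarrow> (\<And>g. g \<in> C \<Longrightarrow> g x = g y) \<Longrightarrow> x = y"
begin

text \<open>Together with \<open>poly_expand\<close>: the functions induced on the torus are exactly
  the linear combinations of the characters in \<open>mon_hull W\<close>.\<close>

lemma mon_hull_poly:
  assumes "u \<in> mon_hull W"
  shows "\<exists>q\<in>poly_funs C. \<forall>s\<in>torus n. q (f s) = ch n u s"
  using assms
proof induction
  case zero
  show ?case by (intro bexI[of _ "\<lambda>_. 1"]) (auto simp: ch_0 intro: poly_funs.const)
next
  case (step w v)
  then obtain p q where "p \<in> poly_funs C" "\<forall>s\<in>torus n. p (f s) = ch n w s"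
    "q \<in> poly_funs C" "\<forall>s\<in>torus n. q (f s) = ch n v s"
    using weight by blast
  then show ?case
    by (intro bexI[of _ "\<lambda>x. p x * q x"]) (auto simp: ch_add intro: poly_funs.mult)
qed

lemma poly_expand:
  assumes "g \<in> poly_funs C"
  shows "\<exists>K c. finite K \<and> K \<subseteq> mon_hull W \<and> (\<forall>s\<in>torus n. g (f s) = (\<Sum>u\<in>K. c u * ch n u s))"
proof -
  have "\<exists>K. finite K \<and> K \<subseteq> mon_hull W \<and> laurent (torus n) (ch n) {} K (\<lambda>s (y::unit). g (f s))"
  proof (rule laurent_poly[OF assms])
    fix g assume "g \<in> C"
    then obtain c where "\<forall>s\<in>torus n. g (f s) = (\<Sum>w\<in>W. c w * ch n w s)" using coord by blast
    then have "laurent (torus n) (ch n) {} W (\<lambda>s (y::unit). g (f s))"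
      unfolding laurent_def by (intro exI[of _ "\<lambda>w _. c w"]) (auto intro: poly_funs.const)
    then show "\<exists>K. finite K \<and> K \<subseteq> mon_hull W \<and> laurent (torus n) (ch n) {} K (\<lambda>s (y::unit). g (f s))"
      using finite_W by (intro exI[of _ W]) (auto intro: mon_base)
  qed (auto intro: mon_hull.zero mon_add ch_0 ch_add)
  then show ?thesis unfolding laurent_def by metis
qed

text \<open>A point \<open>y\<close> of the closure evaluates the functions on the orbit and thereby
  gives a homomorphism from the monoid of weights to the field; invertibility in the monoid makes
  its values nonzero. Extended to all weights it is evaluation at a torus point, which
  \<open>f\<close> sends to \<open>y\<close>.\<close>

lemma closed_if:
  assumes minus: "\<And>w. w \<in> W \<Longrightarrow> - w \<in> mon_hull W"
  shows "closedin (zariski S C) (f ` torus n)"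
proof -
  define I where "I = {g \<in> poly_funs C. \<forall>s\<in>torus n. g (f s) = 0}"
  have agree: "p y = q y"
    if "p \<in> poly_funs C" "q \<in> poly_funs C" "\<And>s. s \<in> torus n \<Longrightarrow> p (f s) = q (f s)" "y \<in> zero_set S I" for p q y
  proof -
    have "(\<lambda>x. p x - q x) \<in> I" unfolding I_def using that by (auto intro: poly_funs_diff)
    then show ?thesis using that(4) unfolding zero_set_def by fastforce
  qed
  obtain Q where Q: "\<And>u. u \<in> mon_hull W \<Longrightarrow> Q u \<in> poly_funs C"
    "\<And>u s. u \<in> mon_hull W \<Longrightarrow> s \<in> torus n \<Longrightarrow> Q u (f s) = ch n u s"
    using mon_hull_poly by metis
  have "y \<in> f ` torus n" if y: "y \<in> zero_set S I" for y
  proof -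
    have add: "Q (u + v) y = Q u y * Q v y" if "u \<in> mon_hull W" "v \<in> mon_hull W" for u v
      using that by (intro agree[OF _ _ _ y, where q = "\<lambda>x. Q u x * Q v x"])
        (auto simp: Q ch_add mon_add intro: poly_funs.mult)
    have Q0: "Q 0 y = 1"
    proof (rule agree[OF Q(1)[OF mon_hull.zero] poly_funs.const _ y])
      show "Q 0 (f s) = 1" if "s \<in> torus n" for s
        using Q(2)[OF mon_hull.zero that] by (simp add: ch_0)
    qed
    have neg: "- u \<in> mon_hull W" if "u \<in> mon_hull W" for u
      using mon_minus[of W u] minus that by blast
    have "Q u y \<noteq> 0" if "u \<in> mon_hull W" for u
      using add[OF that neg[OF that]] Q0 by (auto simp: right_minus)
    with add obtain s where s: "s \<in> torus n" "\<And>u. u \<in> mon_hull W \<Longrightarrow> ch n u s = Q u y"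
      using hom_extend[where L = "mon_hull W" and h = "\<lambda>u. Q u y", OF mon_weights[OF W_weights]
          mon_hull.zero mon_add neg] by blast
    have "f s = y"
    proof (rule separated)
      fix g assume g: "g \<in> C"
      then obtain c where c: "\<forall>s\<in>torus n. g (f s) = (\<Sum>w\<in>W. c w * ch n w s)" using coord by blast
      have "g y = (\<Sum>w\<in>W. c w * Q w y)"
        using g c by (intro agree[OF _ _ _ y, where q = "\<lambda>x. \<Sum>w\<in>W. c w * Q w x"])
          (auto simp: Q mon_base intro: poly_funs.coord intro!: poly_funs_sum poly_funs_cmult)
      then show "g (f s) = g y" using c s by (simp add: mon_base)
    qed (use y s maps in \<open>auto simp: zero_set_def\<close>)
    then show ?thesis using s(1) by blast
  qed
  then have "f ` torus n = zero_set S I"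
    using maps by (auto simp: zero_set_def I_def)
  then show ?thesis
    unfolding closedin_zariski by (intro exI[of _ I]) (auto simp: I_def)
qed

text \<open>
  The weights that are invertible in the monoid span a face, so their indicator function is
  multiplicative and gives a limit point of the orbit.
\<close>

lemma closed_only_if:
  assumes S: "S = zero_set S' F" "F \<subseteq> poly_funs C" "\<And>v. \<exists>y\<in>S'. \<forall>g\<in>C. g y = v g"
    and closed: "closedin (zariski S C) (f ` torus n)" and w: "w \<in> W"
  shows "- w \<in> mon_hull W"
proof (rule ccontr)
  assume nw: "- w \<notin> mon_hull W"
  define eps :: "(nat \<Rightarrow> int) \<Rightarrow> 'k" where "eps u = (if - u \<in> mon_hull W then 1 else 0)" for u
  have eps_add: "eps (u + v) = eps u * eps v" if "u \<in> mon_hull W" "v \<in> mon_hull W" for u v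
  proof -
    have "- (u + v) \<in> mon_hull W \<longleftrightarrow> - u \<in> mon_hull W \<and> - v \<in> mon_hull W"
    proof safe
      assume "- (u + v) \<in> mon_hull W"
      from mon_add[OF this that(2)] mon_add[OF this that(1)]
      show "- u \<in> mon_hull W" "- v \<in> mon_hull W" by (simp_all add: algebra_simps)
    next
      assume "- u \<in> mon_hull W" "- v \<in> mon_hull W"
      from mon_add[OF this] show "- (u + v) \<in> mon_hull W" by simp
    qed
    then show ?thesis by (auto simp: eps_def)
  qed
  have eps_0: "eps 0 = 1" by (simp add: eps_def mon_hull.zero)
  obtain cf where cf: "\<And>g s. g \<in> C \<Longrightarrow> s \<in> torus n \<Longrightarrow> g (f s) = (\<Sum>w\<in>W. cf g w * ch n w s)"
    using coord by metis
  \<comment> \<open>The candidate limit point: each coordinate function keeps its expansion, with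
    every character replaced by its value under \<open>eps\<close>. At first it is only known to lie
    in the ambient space \<open>S'\<close>.\<close>
  obtain y where y: "y \<in> S'" "\<And>g. g \<in> C \<Longrightarrow> g y = (\<Sum>w\<in>W. cf g w * eps w)"
    using S(3)[of "\<lambda>g. \<Sum>w\<in>W. cf g w * eps w"] by blast
  \<comment> \<open>Adjoining \<open>y\<close> as an ideal point \<open>None\<close> of the torus
    lets one expansion, with the same coefficients, hold on the orbit and at
    \<open>y\<close>.\<close>
  define A :: "(nat \<Rightarrow> 'k) option set" where "A = insert None (Some ` torus n)"
  define e where "e u a = (case a of None \<Rightarrow> eps u | Some s \<Rightarrow> ch n u s)" for u and a :: "(nat \<Rightarrow> 'k) option"
  define h where "h a = (case a of None \<Rightarrow> y | Some s \<Rightarrow> f s)" for a :: "(nat \<Rightarrow> 'k) option"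
  have expand: "\<exists>K c. finite K \<and> K \<subseteq> mon_hull W \<and> g y = (\<Sum>u\<in>K. c u * eps u) \<and>
      (\<forall>s\<in>torus n. g (f s) = (\<Sum>u\<in>K. c u * ch n u s))" if g: "g \<in> poly_funs C" for g
  proof -
    have "\<exists>K. finite K \<and> K \<subseteq> mon_hull W \<and> laurent A e {} K (\<lambda>a (u::unit). g (h a))"
    proof (rule laurent_poly[OF g])
      fix g assume "g \<in> C"
      then have "laurent A e {} W (\<lambda>a (u::unit). g (h a))"
        unfolding laurent_def A_def e_def h_def
        by (intro exI[of _ "\<lambda>w _. cf g w"]) (auto simp: y(2) cf intro: poly_funs.const)
      then show "\<exists>K. finite K \<and> K \<subseteq> mon_hull W \<and> laurent A e {} K (\<lambda>a (u::unit). g (h a))"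
        using finite_W by (intro exI[of _ W]) (auto intro: mon_base)
    qed (auto simp: A_def e_def eps_0 eps_add ch_0 ch_add intro: mon_hull.zero mon_add)
    then obtain K c where K: "finite K" "K \<subseteq> mon_hull W"
      "\<And>a. a \<in> A \<Longrightarrow> g (h a) = (\<Sum>u\<in>K. c u () * e u a)"
      unfolding laurent_def by blast
    then show ?thesis
      using K(3)[of None] K(3)[of "Some _"]
      by (intro exI[of _ K] exI[of _ "\<lambda>u. c u ()"]) (auto simp: A_def e_def h_def)
  qed
  \<comment> \<open>By independence of characters an expansion is determined by its values on the
    torus, so a polynomial that is a multiple of one character on the orbit takes the corresponding
    multiple of \<open>eps\<close> at \<open>y\<close>.\<close>
  have eval: "g y = a * eps u"
    if g: "g \<in> poly_funs C" "\<And>s. s \<in> torus n \<Longrightarrow> g (f s) = a * ch n u s" and u: "u \<in> mon_hull W" for g a u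
  proof -
    obtain K c where K: "finite K" "K \<subseteq> mon_hull W" "g y = (\<Sum>v\<in>K. c v * eps v)"
      "\<And>s. s \<in> torus n \<Longrightarrow> g (f s) = (\<Sum>v\<in>K. c v * ch n v s)"
      using expand[OF g(1)] by blast
    define d where "d v = (if v \<in> K then c v else 0) - (if v = u then a else 0)" for v
    have sum: "(\<Sum>v\<in>insert u K. d v * x v) = (\<Sum>v\<in>K. c v * x v) - a * x u" for x :: "(nat \<Rightarrow> int) \<Rightarrow> 'k"
    proof -
      have "(\<Sum>v\<in>insert u K. d v * x v) = (\<Sum>v\<in>insert u K. if v \<in> K then c v * x v else 0)
          - (\<Sum>v\<in>insert u K. if v = u then a * x v else 0)"
        unfolding sum_subtractf[symmetric] d_def by (intro sum.cong) (auto simp: algebra_simps)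
      also have "(\<Sum>v\<in>insert u K. if v \<in> K then c v * x v else 0) = (\<Sum>v\<in>K. c v * x v)"
        using K(1) by (intro sum.mono_neutral_cong_right) auto
      also have "(\<Sum>v\<in>insert u K. if v = u then a * x v else 0) = a * x u"
        using K(1) by (subst sum.delta) auto
      finally show ?thesis .
    qed
    have "d v = 0" if "v \<in> insert u K" for v
    proof (rule ch_independent[OF _ _ _ that])
      show "(\<Sum>v\<in>insert u K. d v * ch n v s) = 0" if "s \<in> torus n" for s
        unfolding sum using K(4)[OF that] g(2)[OF that] by simp
    qed (use K u mon_weights[OF W_weights] in auto)
    then have "(\<Sum>v\<in>insert u K. d v * eps v) = 0" by simp
    then show ?thesis unfolding sum K(3) by simp
  qed
  have vanish: "g y = 0" if "g \<in> poly_funs C" "\<And>s. s \<in> torus n \<Longrightarrow> g (f s) = 0" for g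
  proof -
    have "g y = 0 * eps 0"
      by (rule eval[OF that(1) _ mon_hull.zero]) (simp add: that(2))
    then show ?thesis by simp
  qed
  have "y \<in> S"
    unfolding S(1) zero_set_def
  proof (intro CollectI conjI ballI y(1))
    fix g assume "g \<in> F"
    then show "g y = 0"
      using vanish[of g] S(2) maps unfolding S(1) zero_set_def by blast
  qed
  obtain G where G: "G \<subseteq> poly_funs C" "f ` torus n = zero_set S G"
    using closed unfolding closedin_zariski by blast
  have "y \<in> zero_set S G"
    unfolding zero_set_def
  proof (intro CollectI conjI ballI \<open>y \<in> S\<close>)
    fix g assume g: "g \<in> G"
    have "g (f s) = 0" if "s \<in> torus n" for s
    proof -
      have "f s \<in> zero_set S G" using that unfolding G(2)[symmetric] by blast
      then show ?thesis using g unfolding zero_set_def by blast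
    qed
    then show "g y = 0" using vanish g G(1) by blast
  qed
  then obtain t where t: "t \<in> torus n" "y = f t" unfolding G(2)[symmetric] by blast
  obtain q where q: "q \<in> poly_funs C" "\<And>s. s \<in> torus n \<Longrightarrow> q (f s) = ch n w s"
    using weight[OF w] by blast
  have "q y = 1 * eps w" using q w by (intro eval) (auto intro: mon_base)
  then show False using nw q(2)[OF t(1)] ch_nonzero[OF t(1), of w] t(2) by (simp add: eps_def)
qed

text \<open>Two functions that do not vanish identically on the torus are simultaneously nonzero at
  one of its points. The subspace \<open>Y\<close> is left free so that the image of a subtorus can
  be placed inside the full orbit.\<close>

lemma irreducible_image:
  assumes Y: "f ` torus n \<subseteq> Y"
  shows "irreducible_in (subtopology (zariski S C) Y) (f ` torus n)"
  unfolding irreducible_in_def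
proof (intro conjI allI impI)
  show "f ` torus n \<subseteq> topspace (subtopology (zariski S C) Y)"
    using Y maps by (auto simp: topspace_zariski)
  have "(\<lambda>_. 1) \<in> torus n" by (simp add: torus_def)
  then show "f ` torus n \<noteq> {}" by blast
  fix A B
  assume "closedin (subtopology (zariski S C) Y) A" "closedin (subtopology (zariski S C) Y) B"
    and cover: "f ` torus n \<subseteq> A \<union> B"
  then obtain F G where F: "F \<subseteq> poly_funs C" "A = zero_set S F \<inter> Y"
    and G: "G \<subseteq> poly_funs C" "B = zero_set S G \<inter> Y"
    unfolding closedin_subtopology closedin_zariski by blast
  show "f ` torus n \<subseteq> A \<or> f ` torus n \<subseteq> B"
  proof (rule ccontr)
    assume "\<not> (f ` torus n \<subseteq> A \<or> f ` torus n \<subseteq> B)"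
    then obtain s t where st: "s \<in> torus n" "f s \<notin> A" "t \<in> torus n" "f t \<notin> B" by blast
    then obtain p q where p: "p \<in> F" "p (f s) \<noteq> 0" and q: "q \<in> G" "q (f t) \<noteq> 0"
      using maps Y unfolding F(2) G(2) zero_set_def by blast
    obtain K c where K: "finite K" "K \<subseteq> mon_hull W" "\<And>s. s \<in> torus n \<Longrightarrow> p (f s) = (\<Sum>u\<in>K. c u * ch n u s)"
      using poly_expand[of p] subsetD[OF F(1) p(1)] by auto
    obtain L d where L: "finite L" "L \<subseteq> mon_hull W" "\<And>s. s \<in> torus n \<Longrightarrow> q (f s) = (\<Sum>u\<in>L. d u * ch n u s)"
      using poly_expand[of q] subsetD[OF G(1) q(1)] by auto
    have "(\<Sum>u\<in>K. c u * ch n u s) \<noteq> 0" using p(2) K(3)[OF st(1)] by simp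
    then obtain u where "u \<in> K" "c u * ch n u s \<noteq> 0"
      by (rule sum.not_neutral_contains_not_neutral)
    then have u: "u \<in> K" "c u \<noteq> 0" by auto
    have "(\<Sum>u\<in>L. d u * ch n u t) \<noteq> 0" using q(2) L(3)[OF st(3)] by simp
    then obtain v where "v \<in> L" "d v * ch n v t \<noteq> 0"
      by (rule sum.not_neutral_contains_not_neutral)
    then have v: "v \<in> L" "d v \<noteq> 0" by auto
    have sub: "K \<subseteq> weights n" "L \<subseteq> weights n"
      using K(2) L(2) mon_weights[OF W_weights] by auto
    obtain r where r: "r \<in> torus n" "p (f r) \<noteq> 0" "q (f r) \<noteq> 0"
      using two_laurent_nonzero[of K n u c L v d] K L u v sub by auto
    have "f r \<in> A \<union> B" using cover r(1) by blast
    then show False using r p(1) q(1) unfolding F(2) G(2) zero_set_def by blast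
  qed
qed

end

lemma irreducible_prime:
  fixes C :: "('p \<Rightarrow> 'k::idom) set"
  assumes irr: "irreducible_in (subtopology (zariski S C) Y) Z"
    and p: "p \<in> poly_funs C" and q: "q \<in> poly_funs C" and pq: "\<And>z. z \<in> Z \<Longrightarrow> p z * q z = 0"
  shows "(\<forall>z\<in>Z. p z = 0) \<or> (\<forall>z\<in>Z. q z = 0)"
proof -
  let ?X = "subtopology (zariski S C) Y"
  have cl: "closedin ?X (zero_set S {g} \<inter> Y)" if "g \<in> poly_funs C" for g
    unfolding closedin_subtopology closedin_zariski using that
    by (intro exI[of _ "zero_set S {g}"] conjI exI[of _ "{g}"]) auto
  have Z: "Z \<subseteq> S \<inter> Y" using irr unfolding irreducible_in_def by (simp add: topspace_zariski)
  have "Z \<subseteq> (zero_set S {p} \<inter> Y) \<union> (zero_set S {q} \<inter> Y)"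
    using Z pq by (auto simp: zero_set_def)
  then have "Z \<subseteq> zero_set S {p} \<inter> Y \<or> Z \<subseteq> zero_set S {q} \<inter> Y"
    by (rule irr[unfolded irreducible_in_def, THEN conjunct2, THEN conjunct2, rule_format,
          OF cl[OF p] cl[OF q]])
  then show ?thesis by (auto simp: zero_set_def)
qed

section \<open>Upper bound for the dimension of an orbit\<close>

text \<open>The head of the list is the exponent of the function with the highest index, so that
  passing to the next member of a chain prepends an exponent.\<close>

primrec monomial :: "(nat \<Rightarrow> 'p \<Rightarrow> 'k::comm_ring_1) \<Rightarrow> nat list \<Rightarrow> 'p \<Rightarrow> 'k" where
  "monomial g [] z = 1"
| "monomial g (e # \<alpha>) z = g (length \<alpha>) z ^ e * monomial g \<alpha> z"

definition exponents :: "nat \<Rightarrow> nat \<Rightarrow> nat list set" where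
  "exponents m i = {\<alpha>. set \<alpha> \<subseteq> {..m} \<and> length \<alpha> = i}"

lemma finite_exponents: "finite (exponents m i)"
  unfolding exponents_def by (rule finite_lists_length_eq) simp

lemma card_exponents: "card (exponents m i) = (m + 1) ^ i"
  unfolding exponents_def by (subst card_lists_length_eq) auto

lemma sum_exponents_Suc:
  "(\<Sum>\<alpha>\<in>exponents m (Suc i). F \<alpha>) = (\<Sum>e\<le>m. \<Sum>\<beta>\<in>exponents m i. F (e # \<beta>))"
proof -
  have "exponents m (Suc i) = (\<lambda>(e, \<beta>). e # \<beta>) ` ({..m} \<times> exponents m i)"
    by (auto simp: exponents_def length_Suc_conv image_iff)
  moreover have "inj_on (\<lambda>(e, \<beta>). e # \<beta>) ({..m} \<times> exponents m i)"
    by (auto simp: inj_on_def)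
  ultimately show ?thesis
    by (simp add: sum.reindex sum.cartesian_product case_prod_unfold comp_def)
qed

lemma poly_funs_power: "p \<in> poly_funs C \<Longrightarrow> (\<lambda>x. p x ^ e) \<in> poly_funs C"
  by (induction e) (auto intro: poly_funs.const poly_funs.mult)

lemma poly_funs_monomial:
  assumes "\<And>i. i < length \<alpha> \<Longrightarrow> g i \<in> poly_funs C"
  shows "monomial g \<alpha> \<in> poly_funs C"
  using assms
proof (induction \<alpha>)
  case Nil
  then show ?case using poly_funs.const[of 1 C] by (simp add: fun_eq_iff[symmetric])
next
  case (Cons e \<alpha>)
  then have "(\<lambda>z. g (length \<alpha>) z ^ e * monomial g \<alpha> z) \<in> poly_funs C"
    by (intro poly_funs.mult poly_funs_power) auto
  then show ?case by simp
qed

text \<open>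
  Functions \<open>g i\<close> vanishing on the \<open>i\<close>-th member of a chain of irreducible sets, but not on the
  next one, are algebraically independent.
\<close>

lemma chain_independent:
  fixes Z :: "nat \<Rightarrow> 'p set" and g :: "nat \<Rightarrow> 'p \<Rightarrow> 'k::idom"
  assumes prime: "\<And>i p q. i \<le> d \<Longrightarrow> p \<in> poly_funs C \<Longrightarrow> q \<in> poly_funs C \<Longrightarrow>
      (\<And>z. z \<in> Z i \<Longrightarrow> p z * q z = 0) \<Longrightarrow> (\<forall>z\<in>Z i. p z = 0) \<or> (\<forall>z\<in>Z i. q z = 0)"
    and ne: "Z 0 \<noteq> {}" and sub: "\<And>i. i < d \<Longrightarrow> Z i \<subseteq> Z (Suc i)"
    and g: "\<And>i. i < d \<Longrightarrow> g i \<in> poly_funs C" "\<And>i z. i < d \<Longrightarrow> z \<in> Z i \<Longrightarrow> g i z = 0"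
      "\<And>i. i < d \<Longrightarrow> \<exists>z\<in>Z (Suc i). g i z \<noteq> 0"
  shows "i \<le> d \<Longrightarrow> (\<And>z. z \<in> Z i \<Longrightarrow> (\<Sum>\<alpha>\<in>exponents m i. c \<alpha> * monomial g \<alpha> z) = 0) \<Longrightarrow>
    \<alpha> \<in> exponents m i \<Longrightarrow> c \<alpha> = 0"
proof (induction i arbitrary: c \<alpha>)
  case 0
  obtain z where "z \<in> Z 0" using ne by blast
  moreover have "exponents m 0 = {[]}" by (auto simp: exponents_def)
  ultimately show ?case using "0.prems"(2)[of z] "0.prems"(3) by simp
next
  case (Suc i)
  \<comment> \<open>The relation is read as a polynomial in \<open>g i\<close> whose coefficients
    \<open>G e\<close> involve the earlier functions only.\<close>
  define G where "G e z = (\<Sum>\<beta>\<in>exponents m i. c (e # \<beta>) * monomial g \<beta> z)" for e z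
  have G: "G e \<in> poly_funs C" for e
    unfolding G_def[abs_def] using g(1) Suc.prems(1)
    by (intro poly_funs_sum poly_funs_cmult poly_funs_monomial) (auto simp: exponents_def)
  have id: "i < d" "i \<le> d" using Suc.prems(1) by auto
  have "\<forall>\<beta>\<in>exponents m i. c (e # \<beta>) = 0" if "e \<le> m" for e
    using that
  proof (induction e rule: less_induct)
    case (less e)
    \<comment> \<open>What remains of the relation after division by the lowest power of
      \<open>g i\<close>. It vanishes on \<open>Z (Suc i)\<close> by primeness, and on
      \<open>Z i\<close>, where \<open>g i\<close> is zero, only \<open>G e\<close>
      survives.\<close>
    define R where "R z = (\<Sum>e'\<in>{e..m}. g i z ^ (e' - e) * G e' z)" for z
    have "g i z ^ e * R z = 0" if z: "z \<in> Z (Suc i)" for z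
    proof -
      have "G e' z = 0" if "e' < e" for e'
        unfolding G_def using less that by (intro sum.neutral) simp
      then have "(\<Sum>e'\<le>m. g i z ^ e' * G e' z) = (\<Sum>e'\<in>{e..m}. g i z ^ e' * G e' z)"
        by (intro sum.mono_neutral_right) (auto simp: not_le)
      also have "\<dots> = g i z ^ e * R z"
        unfolding R_def sum_distrib_left
        by (intro sum.cong) (auto simp: mult.assoc[symmetric] simp flip: power_add)
      finally have "g i z ^ e * R z = (\<Sum>e'\<le>m. g i z ^ e' * G e' z)" by simp
      also have "\<dots> = (\<Sum>\<alpha>\<in>exponents m (Suc i). c \<alpha> * monomial g \<alpha> z)"
        unfolding sum_exponents_Suc G_def sum_distrib_left
        by (intro sum.cong) (auto simp: exponents_def mult_ac)
      also have "\<dots> = 0" by (rule Suc.prems(2)[OF z])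
      finally show ?thesis .
    qed
    moreover have "R \<in> poly_funs C"
      unfolding R_def[abs_def] using G g(1)[OF id(1)]
      by (intro poly_funs_sum poly_funs.mult poly_funs_power) auto
    moreover have "\<exists>z\<in>Z (Suc i). g i z ^ e \<noteq> 0" using g(3)[OF id(1)] by auto
    ultimately have R: "\<forall>z\<in>Z (Suc i). R z = 0"
      using prime[OF Suc.prems(1), of "\<lambda>z. g i z ^ e" R] poly_funs_power[OF g(1)[OF id(1)]] by blast
    have "G e z = 0" if z: "z \<in> Z i" for z
    proof -
      have "R z = (\<Sum>e'\<in>{e..m}. if e' = e then G e' z else 0)"
        unfolding R_def by (intro sum.cong) (auto simp: g(2)[OF id(1) z] power_0_left)
      also have "\<dots> = G e z" using less.prems by (simp add: sum.delta)
      finally show ?thesis using R sub[OF id(1)] z by auto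
    qed
    then show ?case
      using Suc.IH[OF id(2), of "\<lambda>\<beta>. c (e # \<beta>)"] unfolding G_def by blast
  qed
  moreover obtain e \<beta> where "\<alpha> = e # \<beta>" "e \<le> m" "\<beta> \<in> exponents m i"
    using Suc.prems(3) by (auto simp: exponents_def length_Suc_conv)
  ultimately show ?case by blast
qed

text \<open>Gaussian elimination, one column \<open>u\<close> per step: a pivot row \<open>y\<close>
  clears the column, and its own coefficient \<open>- t\<close> is chosen so that the relation holds
  in column \<open>u\<close> as well.\<close>

lemma linear_dependence:
  fixes a :: "'x \<Rightarrow> 'u \<Rightarrow> 'k::field"
  assumes "finite K" "finite A" "card K < card A"
  shows "\<exists>c. (\<exists>x\<in>A. c x \<noteq> 0) \<and> (\<forall>u\<in>K. (\<Sum>x\<in>A. c x * a x u) = 0)"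
  using assms
proof (induction K arbitrary: A a)
  case empty
  then obtain x where "x \<in> A" by fastforce
  then show ?case by (intro exI[of _ "\<lambda>_. 1"]) auto
next
  case (insert u K)
  show ?case
  proof (cases "\<forall>x\<in>A. a x u = 0")
    case True
    have "card K < card A" using insert by simp
    from insert.IH[OF insert.prems(1) this, of a] obtain c
      where "\<exists>x\<in>A. c x \<noteq> 0" "\<forall>u\<in>K. (\<Sum>x\<in>A. c x * a x u) = 0" by blast
    then show ?thesis using True by (intro exI[of _ c]) auto
  next
    case False
    then obtain y where y: "y \<in> A" "a y u \<noteq> 0" by blast
    let ?A = "A - {y}"
    have A: "finite ?A" "card K < card ?A" using insert y by auto
    from insert.IH[OF A, of "\<lambda>x v. a x v - a x u / a y u * a y v"]
    obtain c where c: "\<exists>x\<in>?A. c x \<noteq> 0" "\<forall>v\<in>K. (\<Sum>x\<in>?A. c x * (a x v - a x u / a y u * a y v)) = 0"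
      by blast
    define t where "t = (\<Sum>x\<in>?A. c x * a x u) / a y u"
    have split: "(\<Sum>x\<in>A. (c(y := - t)) x * a x v) = (\<Sum>x\<in>?A. c x * a x v) - t * a y v" for v
      using insert.prems(1) y(1) by (simp add: sum.remove[of A y])
    have "(\<Sum>x\<in>A. (c(y := - t)) x * a x v) = 0" if "v \<in> insert u K" for v
    proof (cases "v = u")
      case False
      have "(\<Sum>x\<in>?A. c x * (a x v - a x u / a y u * a y v)) = (\<Sum>x\<in>?A. c x * a x v) - t * a y v"
        unfolding t_def by (simp add: right_diff_distrib sum_subtractf sum_distrib_left sum_distrib_right
            sum_divide_distrib mult_ac)
      then show ?thesis unfolding split using c(2) that False by auto
    qed (use split y t_def in simp)
    then show ?thesis using c(1) by (intro exI[of _ "c(y := - t)"]) auto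
  qed
qed

context toric_map
begin

abbreviation "orbit_space \<equiv> subtopology (zariski S C) (f ` torus n)"

text \<open>A chain of length \<open>d\<close> yields \<open>d\<close> algebraically independent
  functions. Their \<open>(m + 1) ^ d\<close> monomials with exponents up to \<open>m\<close> are
  combinations of characters in a box of side linear in \<open>m\<close>, and the number of these
  characters grows at most like \<open>m\<close> to the number of leading indices.\<close>

lemma krull_dim_le:
  assumes minus: "\<And>w. w \<in> W \<Longrightarrow> - w \<in> mon_hull W"
  shows "krull_dim orbit_space \<le> enat (card (leading (mon_hull W)))"
  unfolding krull_dim_def
proof (rule Sup_least, safe)
  fix d and Z :: "nat \<Rightarrow> 'p set"
  assume Z: "\<forall>i\<le>d. closedin orbit_space (Z i) \<and> irreducible_in orbit_space (Z i)"
    and strict: "\<forall>i<d. Z i \<subset> Z (Suc i)"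
  let ?L = "mon_hull W" and ?T = "torus n :: (nat \<Rightarrow> 'k) set"
  have L: "?L \<subseteq> weights n" by (rule mon_weights[OF W_weights])
  have diff: "u - v \<in> ?L" if "u \<in> ?L" "v \<in> ?L" for u v
    using mon_add[OF that(1) mon_minus[OF minus that(2)]] by simp
  have ZO: "Z i \<subseteq> S \<inter> f ` ?T" if "i \<le> d" for i
    using Z that unfolding irreducible_in_def by (simp add: topspace_zariski)
  have "\<exists>p\<in>poly_funs C. (\<forall>z\<in>Z i. p z = 0) \<and> (\<exists>z\<in>Z (Suc i). p z \<noteq> 0)" if i: "i < d" for i
  proof -
    obtain F where F: "F \<subseteq> poly_funs C" "Z i = zero_set S F \<inter> f ` ?T"
      using Z[rule_format, of i] i unfolding closedin_subtopology closedin_zariski by auto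
    obtain z where z: "z \<in> Z (Suc i)" "z \<notin> Z i" using strict i by blast
    then have "z \<in> S \<inter> f ` ?T" using ZO[of "Suc i"] i by auto
    then obtain p where "p \<in> F" "p z \<noteq> 0" using z(2) unfolding F(2) zero_set_def by blast
    then show ?thesis using F z unfolding zero_set_def by blast
  qed
  then obtain g where g: "\<And>i. i < d \<Longrightarrow> g i \<in> poly_funs C" "\<And>i z. i < d \<Longrightarrow> z \<in> Z i \<Longrightarrow> g i z = 0"
    "\<And>i. i < d \<Longrightarrow> \<exists>z\<in>Z (Suc i). g i z \<noteq> 0"
    by metis
  have prime: "(\<forall>z\<in>Z i. p z = 0) \<or> (\<forall>z\<in>Z i. q z = 0)"
    if "i \<le> d" "p \<in> poly_funs C" "q \<in> poly_funs C" "\<And>z. z \<in> Z i \<Longrightarrow> p z * q z = 0" for i p q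
    using irreducible_prime[OF conjunct2[OF Z[rule_format, OF that(1)]] that(2-4)] .
  have ne: "Z 0 \<noteq> {}" using Z unfolding irreducible_in_def by blast
  have sub: "Z i \<subseteq> Z (Suc i)" if "i < d" for i using strict that by blast
  have "\<exists>K c. finite K \<and> K \<subseteq> ?L \<and> (\<forall>s\<in>?T. g i (f s) = (\<Sum>u\<in>K. c u * ch n u s))" if "i < d" for i
    using poly_expand[OF g(1)[OF that]] .
  then obtain K c where K: "\<And>i. i < d \<Longrightarrow> finite (K i)" "\<And>i. i < d \<Longrightarrow> K i \<subseteq> ?L"
    "\<And>i s. i < d \<Longrightarrow> s \<in> ?T \<Longrightarrow> g i (f s) = (\<Sum>u\<in>K i. c i u * ch n u s)"
    by metis
  have "finite ((\<lambda>(u, j). nat \<bar>u j\<bar>) ` ((\<Union>i<d. K i) \<times> {..<n}))" using K(1) by auto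
  then obtain b where "\<forall>k\<in>(\<lambda>(u, j). nat \<bar>u j\<bar>) ` ((\<Union>i<d. K i) \<times> {..<n}). k \<le> b"
    using finite_nat_set_iff_bounded_le[THEN iffD1] by blast
  then have b1: "nat \<bar>u j\<bar> \<le> b" if "i < d" "u \<in> K i" "j < n" for u i j
    using that by fastforce
  have b: "\<bar>u j\<bar> \<le> int b" if "i < d" "u \<in> K i" for u i j
  proof (cases "j < n")
    case False
    have "u \<in> weights n" using that K(2) L by blast
    then show ?thesis using False by (simp add: weights_def)
  qed (use b1[OF that] in force)
  define B where "B k = {u \<in> ?L. \<forall>j. \<bar>u j\<bar> \<le> int k}" for k
  have finB: "finite (B k)" for k
    unfolding B_def by (rule card_box(1)[OF L diff])
  have B_mono: "B k \<subseteq> B l" if "k \<le> l" for k l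
    using that unfolding B_def by (auto intro: order_trans)
  let ?lau = "\<lambda>k h. laurent ?T (ch n) {} (B k) (\<lambda>s (y::unit). h (f s))"
  have lau_mono: "?lau l h" if "?lau k h" "k \<le> l" for k l h
    using laurent_mono[OF that(1) B_mono[OF that(2)] finB] .
  have lau_mult: "?lau (k + l) (\<lambda>x. h x * h' x)" if "?lau k h" "?lau l h'" for k l h h'
  proof (rule laurent_mono[OF laurent_mult[OF that finB finB]])
    show "(\<lambda>(u, v). u + v) ` (B k \<times> B l) \<subseteq> B (k + l)"
    proof safe
      fix u v assume uv: "u \<in> B k" "v \<in> B l"
      have "\<bar>(u + v) j\<bar> \<le> int (k + l)" for j
      proof -
        have "\<bar>u j\<bar> \<le> int k" "\<bar>v j\<bar> \<le> int l" using uv by (auto simp: B_def)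
        then show ?thesis unfolding plus_fun_apply by linarith
      qed
      then show "u + v \<in> B (k + l)"
        using uv mon_add by (auto simp: B_def)
    qed
  qed (auto simp: ch_add finB)
  have lau_1: "?lau 0 (\<lambda>_. 1)"
  proof -
    have "laurent ?T (ch n) {} {0} (\<lambda>s (y::unit). 1)"
      unfolding laurent_def by (intro exI[of _ "\<lambda>_ _. 1"]) (auto simp: ch_0 intro: poly_funs.const)
    then show ?thesis
      by (rule laurent_mono) (auto simp: finB, auto simp: B_def mon_hull.zero zero_fun_apply)
  qed
  have lau_g: "?lau b (g i)" if i: "i < d" for i
  proof -
    have "laurent ?T (ch n) {} (K i) (\<lambda>s (y::unit). g i (f s))"
      unfolding laurent_def using K(3)[OF i]
      by (intro exI[of _ "\<lambda>u _. c i u"]) (auto intro: poly_funs.const)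
    then show ?thesis
      using K(2)[OF i] b[OF i] by (intro laurent_mono[OF _ _ finB]) (auto simp: B_def)
  qed
  have lau_power: "?lau (e * b) (\<lambda>x. g i x ^ e)" if "i < d" for i e
    by (induction e) (use lau_1 lau_mult[OF lau_g[OF that]] in auto)
  have lau_monomial: "?lau (length \<alpha> * (m * b)) (monomial g \<alpha>)"
    if "length \<alpha> \<le> d" "set \<alpha> \<subseteq> {..m}" for \<alpha> m
    using that
  proof (induction \<alpha>)
    case (Cons e \<alpha>)
    have "?lau (m * b) (\<lambda>x. g (length \<alpha>) x ^ e)"
      using lau_mono[OF lau_power[of "length \<alpha>" e], of "m * b"] Cons.prems by simp
    then show ?case using lau_mult[OF _ Cons.IH] Cons.prems by simp
  qed (use lau_1 in simp)
  have "(m + 1) ^ d \<le> (2 * ((d * b) * m) + 1) ^ card (leading ?L)" for m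
  proof -
    let ?K = "B (d * (m * b))"
    have "\<exists>a. \<forall>s\<in>?T. monomial g \<alpha> (f s) = (\<Sum>u\<in>?K. a u * ch n u s)" if "\<alpha> \<in> exponents m d" for \<alpha>
      using lau_monomial[of \<alpha> m] that unfolding laurent_def exponents_def by auto
    then obtain a where a: "\<And>\<alpha> s. \<alpha> \<in> exponents m d \<Longrightarrow> s \<in> ?T \<Longrightarrow>
        monomial g \<alpha> (f s) = (\<Sum>u\<in>?K. a \<alpha> u * ch n u s)"
      by metis
    \<comment> \<open>Fewer characters than monomials would force a linear relation among the
      monomials on the largest set \<open>Z d\<close> of the chain.\<close>
    have "\<not> card ?K < card (exponents m d)"
    proof
      assume "card ?K < card (exponents m d)"
      from linear_dependence[OF finB finite_exponents this, of a]
      obtain x where x: "\<exists>\<alpha>\<in>exponents m d. x \<alpha> \<noteq> 0"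
        "\<forall>u\<in>?K. (\<Sum>\<alpha>\<in>exponents m d. x \<alpha> * a \<alpha> u) = 0"
        by blast
      have zero: "(\<Sum>\<alpha>\<in>exponents m d. x \<alpha> * monomial g \<alpha> z) = 0" if z: "z \<in> Z d" for z
      proof -
        obtain s where s: "s \<in> ?T" "z = f s" using ZO[of d] z by blast
        have "(\<Sum>\<alpha>\<in>exponents m d. x \<alpha> * monomial g \<alpha> z)
            = (\<Sum>\<alpha>\<in>exponents m d. \<Sum>u\<in>?K. x \<alpha> * a \<alpha> u * ch n u s)"
          unfolding s(2) using a s(1) by (simp add: sum_distrib_left mult.assoc)
        also have "\<dots> = (\<Sum>u\<in>?K. (\<Sum>\<alpha>\<in>exponents m d. x \<alpha> * a \<alpha> u) * ch n u s)"
          unfolding sum_distrib_right by (rule sum.swap)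
        also have "\<dots> = 0" using x(2) by simp
        finally show ?thesis .
      qed
      have "x \<alpha> = 0" if "\<alpha> \<in> exponents m d" for \<alpha>
        by (rule chain_independent[OF prime ne sub g order_refl zero that])
      with x(1) show False by blast
    qed
    then have "(m + 1) ^ d \<le> card ?K" by (simp add: card_exponents)
    also have "\<dots> \<le> (2 * (d * (m * b)) + 1) ^ card (leading ?L)"
      unfolding B_def by (rule card_box(2)[OF L diff])
    finally show ?thesis by (simp add: mult_ac)
  qed
  then have "d \<le> card (leading ?L)" by (rule growth_bound)
  then show "enat d \<le> enat (card (leading ?L))" by simp
qed

end


section \<open>Lower bound for the dimension of an orbit\<close>

definition subtorus :: "nat set \<Rightarrow> (nat \<Rightarrow> 'k::field) \<Rightarrow> nat \<Rightarrow> 'k" where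
  "subtorus J s = (\<lambda>i. if i \<in> J then s i else 1)"

definition cut :: "nat set \<Rightarrow> (nat \<Rightarrow> int) \<Rightarrow> nat \<Rightarrow> int" where
  "cut J u = (\<lambda>i. if i \<in> J then u i else 0)"

lemma subtorus_torus: "s \<in> torus n \<Longrightarrow> subtorus J s \<in> torus n"
  by (auto simp: subtorus_def torus_def)

lemma ch_subtorus: "ch n u (subtorus J s) = ch n (cut J u) s"
  unfolding ch_def subtorus_def cut_def by (intro prod.cong) auto

lemma cut_mon_hull: "u \<in> mon_hull W \<Longrightarrow> cut J u \<in> mon_hull (cut J ` W)"
proof (induction rule: mon_hull.induct)
  case zero
  have "cut J 0 = 0" by (auto simp: cut_def zero_fun_apply)
  then show ?case using mon_hull.zero by metis
next
  case (step w v)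
  have "cut J (w + v) = cut J w + cut J v" by (auto simp: cut_def plus_fun_apply)
  moreover have "cut J w + cut J v \<in> mon_hull (cut J ` W)"
    using step by (intro mon_hull.step) auto
  ultimately show ?case by metis
qed

context toric_map
begin

lemma toric_map_subtorus: "toric_map n S C (\<lambda>s. f (subtorus J s)) (cut J ` W)"
proof
  fix g assume "g \<in> C"
  then obtain c where c: "\<forall>s\<in>torus n. g (f s) = (\<Sum>w\<in>W. c w * ch n w s)" using coord by blast
  \<comment> \<open>Distinct weights may restrict to the same weight of the subtorus; their
    coefficients are added.\<close>
  define c' where "c' v = (\<Sum>w\<in>{w \<in> W. cut J w = v}. c w)" for v
  have "g (f (subtorus J s)) = (\<Sum>v\<in>cut J ` W. c' v * ch n v s)" if s: "s \<in> torus n" for s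
  proof -
    have "g (f (subtorus J s)) = (\<Sum>w\<in>W. c w * ch n (cut J w) s)"
      using c subtorus_torus[OF s] by (simp add: ch_subtorus)
    also have "\<dots> = (\<Sum>v\<in>cut J ` W. \<Sum>w\<in>{w \<in> W. cut J w = v}. c w * ch n (cut J w) s)"
      by (rule sum.image_gen[OF finite_W])
    also have "\<dots> = (\<Sum>v\<in>cut J ` W. c' v * ch n v s)"
      unfolding c'_def sum_distrib_right by (intro sum.cong) auto
    finally show ?thesis .
  qed
  then show "\<exists>c. \<forall>s\<in>torus n. g (f (subtorus J s)) = (\<Sum>v\<in>cut J ` W. c v * ch n v s)" by blast
next
  fix v assume "v \<in> cut J ` W"
  then obtain w where w: "w \<in> W" "v = cut J w" by blast
  then obtain q where "q \<in> poly_funs C" "\<forall>s\<in>torus n. q (f s) = ch n w s" using weight by blast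
  then show "\<exists>q\<in>poly_funs C. \<forall>s\<in>torus n. q (f (subtorus J s)) = ch n v s"
    using w(2) by (intro bexI[of _ q]) (auto simp: subtorus_torus ch_subtorus)
next
  show "cut J ` W \<subseteq> weights n" using W_weights by (auto simp: cut_def weights_def)
qed (use maps subtorus_torus finite_W separated in auto)

text \<open>
  The orbits of the coordinate subtori belonging to the largest leading indices form a chain: the
  characters with the next smaller leading index are trivial on one, but not on the next one.
\<close>

lemma krull_dim_ge:
  assumes minus: "\<And>w. w \<in> W \<Longrightarrow> - w \<in> mon_hull W"
  shows "enat (card (leading (mon_hull W))) \<le> krull_dim orbit_space"
proof -
  let ?L = "mon_hull W" and ?T = "torus n :: (nat \<Rightarrow> 'k) set"
  have L: "?L \<subseteq> weights n" by (rule mon_weights[OF W_weights])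
  \<comment> \<open>Decreasing order: \<open>J i\<close> below consists of the \<open>i\<close>
    largest leading indices.\<close>
  define p where "p = rev (sorted_list_of_set (leading ?L))"
  define r where "r = card (leading ?L)"
  have fin: "finite (leading ?L)" by (rule finite_leading[OF L])
  have len: "length p = r" by (simp add: p_def r_def)
  have set: "set p = leading ?L" using fin by (simp add: p_def)
  have "sorted_wrt (\<lambda>x y. y < x) p"
    unfolding p_def sorted_wrt_rev using fin by simp
  then have desc: "p ! b < p ! a" if "a < b" "b < r" for a b
    using that len by (simp add: sorted_wrt_iff_nth_less)
  define J where "J i = (\<lambda>a. p ! a) ` {..<i}" for i
  define Z where "Z i = (\<lambda>s. f (subtorus (J i) s)) ` ?T" for i
  have sub: "Z i \<subseteq> f ` ?T" for i
    unfolding Z_def using subtorus_torus by blast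
  have "closedin orbit_space (Z i) \<and> irreducible_in orbit_space (Z i)" for i
  proof -
    interpret sub: toric_map n S C "\<lambda>s. f (subtorus (J i) s)" "cut (J i) ` W"
      by (rule toric_map_subtorus)
    have neg: "- v \<in> mon_hull (cut (J i) ` W)" if v: "v \<in> cut (J i) ` W" for v
    proof -
      obtain w where w: "w \<in> W" "v = cut (J i) w" using v by blast
      have "- v = cut (J i) (- w)" by (auto simp: cut_def w(2) uminus_apply)
      then show ?thesis using cut_mon_hull[OF minus[OF w(1)], of "J i"] by metis
    qed
    have "closedin (zariski S C) (Z i)" unfolding Z_def by (rule sub.closed_if[OF neg])
    then have "closedin orbit_space (Z i)" using sub unfolding closedin_subtopology by blast
    moreover have "irreducible_in orbit_space (Z i)"
      unfolding Z_def by (rule sub.irreducible_image) (use sub in \<open>simp add: Z_def\<close>)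
    ultimately show ?thesis by blast
  qed
  moreover have "Z i \<subset> Z (Suc i)" if i: "i < r" for i
  proof
    have "J i \<subseteq> J (Suc i)" by (auto simp: J_def)
    then have eq: "subtorus (J (Suc i)) (subtorus (J i) s) = subtorus (J i) s" for s :: "nat \<Rightarrow> 'k"
      by (auto simp: subtorus_def fun_eq_iff)
    show "Z i \<subseteq> Z (Suc i)"
      unfolding Z_def
    proof (rule image_subsetI)
      fix s :: "nat \<Rightarrow> 'k" assume "s \<in> torus n"
      then show "f (subtorus (J i) s) \<in> (\<lambda>s. f (subtorus (J (Suc i)) s)) ` torus n"
        by (intro image_eqI[of _ _ "subtorus (J i) s"] subtorus_torus) (simp_all add: eq)
    qed
    have "p ! i \<in> leading ?L" using i len set nth_mem by metis
    then obtain u where u: "u \<in> ?L" "u (p ! i) \<noteq> 0" "\<And>l. l > p ! i \<Longrightarrow> u l = 0"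
      unfolding leading_def by blast
    then have pn: "p ! i < n" using L by (force simp: weights_def not_less[symmetric])
    obtain q where q: "\<And>s. s \<in> ?T \<Longrightarrow> q (f s) = ch n u s" using mon_hull_poly[OF u(1)] by blast
    have one: "q z = 1" if z: "z \<in> Z i" for z
    proof -
      obtain s where s: "s \<in> ?T" "z = f (subtorus (J i) s)" using z unfolding Z_def by blast
      have "cut (J i) u l = 0" for l
        unfolding cut_def J_def using u(3) desc i by auto
      then have "ch n (cut (J i) u) s = 1" by (simp add: ch_def)
      then show ?thesis using s q[OF subtorus_torus[OF s(1)]] by (simp add: ch_subtorus)
    qed
    \<comment> \<open>Read as a statement on the Laurent polynomial \<open>z powi e - 1\<close> with
      \<open>e = u (p ! i)\<close>, which is nonzero, so only finitely many \<open>z\<close> satisfy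
      \<open>z powi e = 1\<close>.\<close>
    have "finite {z :: 'k. z \<noteq> 0 \<and> (\<Sum>j\<in>{0, u (p ! i)}. (if j = 0 then -1 else 1) * z powi j) = 0}"
      by (rule finite_laurent_roots[of _ "u (p ! i)"]) auto
    then have "finite ({0} \<union> {z :: 'k. z \<noteq> 0 \<and> z powi (u (p ! i)) = 1})"
      using u(2) by simp
    then obtain z :: 'k where z: "z \<noteq> 0" "z powi (u (p ! i)) \<noteq> 1"
      using alg_closed_infinite ex_new_if_finite by blast
    define s where "s = (\<lambda>l. if l = p ! i then z else 1)"
    have s: "s \<in> ?T" using z(1) by (simp add: s_def torus_def)
    have "subtorus (J (Suc i)) s = s" by (auto simp: subtorus_def s_def J_def)
    then have "f s \<in> Z (Suc i)" unfolding Z_def using s by (metis imageI)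
    moreover have "ch n u s = (\<Prod>l<n. if l = p ! i then z powi (u (p ! i)) else 1)"
      unfolding ch_def s_def by (intro prod.cong) auto
    then have "q (f s) \<noteq> 1" using q[OF s] z(2) pn by (simp add: prod.delta)
    ultimately show "Z i \<noteq> Z (Suc i)" using one by blast
  qed
  ultimately show ?thesis
    unfolding krull_dim_def r_def[symmetric] by (intro Sup_upper) blast
qed

lemma krull_dim_orbit:
  assumes "\<And>w. w \<in> W \<Longrightarrow> - w \<in> mon_hull W"
  shows "krull_dim orbit_space = enat (card (leading (mon_hull W)))"
  using krull_dim_le krull_dim_ge assms by (intro antisym) auto

end


section \<open>Orbit weights for an algebraic torus\<close>

definition emb :: "nat \<Rightarrow> (nat \<Rightarrow> 'k::alg_closed_field) \<Rightarrow> nat \<Rightarrow> 'k" where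
  "emb n s = (\<lambda>j\<in>{..<2 * n}. if j < n then s j else inverse (s (j - n)))"

text \<open>The unit vector \<open>e_j\<close> for \<open>j < n\<close>, and the negative of
  \<open>e_(j - n)\<close> for the remaining indices: the weights of the \<open>2 * n\<close>
  coordinates of the standard torus.\<close>

definition emb_weight :: "nat \<Rightarrow> nat \<Rightarrow> nat \<Rightarrow> int" where
  "emb_weight n j = (\<lambda>i. if i = (if j < n then j else j - n) then (if j < n then 1 else -1) else 0)"

lemma emb_weight_weights: "j < 2 * n \<Longrightarrow> emb_weight n j \<in> weights n"
  by (auto simp: emb_weight_def weights_def)

lemma ch_emb_weight:
  assumes "j < 2 * n"
  shows "ch n (emb_weight n j) s = emb n s j"
proof -
  define l where "l = (if j < n then j else j - n)"
  have l: "l < n" using assms by (auto simp: l_def)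
  have "ch n (emb_weight n j) s = (\<Prod>i<n. if i = l then emb n s j else 1)"
    unfolding ch_def emb_weight_def emb_def l_def using assms
    by (intro prod.cong) (auto simp: power_int_minus)
  then show ?thesis using l by (simp add: prod.delta)
qed

lemma emb_image: "emb n ` torus n = carrier (std_torus n :: 'k::alg_closed_field alg_group)"
proof
  show "emb n ` torus n \<subseteq> carrier (std_torus n :: 'k alg_group)"
    by (auto simp: emb_def torus_def std_torus_def affine_space_def split: if_splits)
  show "carrier (std_torus n :: 'k alg_group) \<subseteq> emb n ` torus n"
  proof
    fix x :: "nat \<Rightarrow> 'k" assume "x \<in> carrier (std_torus n)"
    then have x: "x \<in> extensional {..<2 * n}" "\<And>i. i < n \<Longrightarrow> x i * x (n + i) = 1"
      by (auto simp: std_torus_def affine_space_def PiE_def)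
    have "inverse (x (j - n)) = x j" if "\<not> j < n" "j < 2 * n" for j
      using x(2)[of "j - n"] that by (intro inverse_unique) auto
    then have "x = emb n x"
      unfolding emb_def using x(1) by (auto simp: extensional_def)
    moreover have "x \<in> torus n" using x(2) unfolding torus_def by force
    ultimately show "x \<in> emb n ` torus n" by blast
  qed
qed

lemma emb_mult: "emb n (\<lambda>i. s i * t i) = emb n s \<otimes>\<^bsub>std_torus n\<^esub> emb n t"
  by (auto simp: emb_def std_torus_def)

lemma emb_poly_laurent:
  fixes p :: "(nat \<Rightarrow> 'k::alg_closed_field) \<Rightarrow> 'k"
  assumes "p \<in> poly_funs (coords (2 * n))"
  shows "\<exists>K. finite K \<and> K \<subseteq> weights n \<and> laurent (torus n) (ch n) D K (\<lambda>s y. p (emb n s))"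
proof (rule laurent_poly[OF assms])
  fix f :: "(nat \<Rightarrow> 'k) \<Rightarrow> 'k" assume "f \<in> coords (2 * n)"
  then obtain j where j: "j < 2 * n" "f = (\<lambda>x. x j)" unfolding coords_def by blast
  have "laurent (torus n) (ch n) D {emb_weight n j} (\<lambda>s y. 1 * ch n (emb_weight n j) s)"
    by (rule laurent_const[OF poly_funs.const])
  then show "\<exists>K. finite K \<and> K \<subseteq> weights n \<and> laurent (torus n) (ch n) D K (\<lambda>s y. f (emb n s))"
    using j by (intro exI[of _ "{emb_weight n j}"]) (simp add: ch_emb_weight emb_weight_weights)
qed (auto intro: weights_0 weights_add ch_0 ch_add)

text \<open>\<open>\<phi>\<close> stands for an isomorphism onto the standard torus and
  \<open>\<psi>\<close> for its inverse composed with \<open>emb n\<close>. Regularity of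
  \<open>\<psi>\<close> yields weight expansions for actions of \<open>T\<close>; regularity of
  \<open>\<phi>\<close> turns the coordinate characters into actions of \<open>T\<close> on
  lines.\<close>

locale torus_parametrization =
  fixes n :: nat and T :: "'k::alg_closed_field alg_group"
    and \<phi> \<psi> :: "(nat \<Rightarrow> 'k) \<Rightarrow> (nat \<Rightarrow> 'k)"
  assumes group_T: "group T"
    and phi_hom: "\<phi> \<in> hom T (std_torus n)"
    and phi_poly: "j < 2 * n \<Longrightarrow> \<exists>p\<in>poly_funs (coords (gdim T)). \<forall>g\<in>carrier T. \<phi> g j = p g"
    and psi_image: "\<psi> ` torus n = carrier T"
    and psi_mult: "s \<in> torus n \<Longrightarrow> t \<in> torus n \<Longrightarrow> \<psi> (\<lambda>i. s i * t i) = \<psi> s \<otimes>\<^bsub>T\<^esub> \<psi> t"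
    and psi_poly: "j < gdim T \<Longrightarrow> \<exists>p\<in>poly_funs (coords (2 * n)). \<forall>s\<in>torus n. \<psi> s j = p (emb n s)"
    and phi_psi: "s \<in> torus n \<Longrightarrow> \<phi> (\<psi> s) = emb n s"

lemma exists_torus_parametrization:
  assumes "algebraic_torus n T"
  shows "\<exists>\<phi> \<psi>. torus_parametrization n T \<phi> \<psi>"
proof -
  let ?H = "std_torus n :: 'a alg_group"
  have gr: "group T" using assms by (simp add: algebraic_torus_def linear_algebraic_group_def)
  obtain \<phi> where iso: "\<phi> \<in> iso T ?H"
    and m1: "morphism (carrier T) (coords (gdim T)) (gdim ?H) (carrier ?H) \<phi>"
    and m2: "morphism (carrier ?H) (coords (gdim ?H)) (gdim T) (carrier T) (inv_into (carrier T) \<phi>)"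
    using assms unfolding algebraic_torus_def alg_group_iso_def by blast
  have dim: "gdim ?H = 2 * n" by (simp add: std_torus_def)
  let ?i = "inv_into (carrier T) \<phi>"
  have iso': "?i \<in> iso ?H T" using group.iso_set_sym[OF gr iso] .
  have emb: "emb n s \<in> carrier ?H" if "s \<in> torus n" for s :: "nat \<Rightarrow> 'a"
    using that emb_image by blast
  have bij: "bij_betw \<phi> (carrier T) (carrier ?H)" using iso by (simp add: iso_def)
  have "torus_parametrization n T \<phi> (\<lambda>s. ?i (emb n s))"
  proof (rule torus_parametrization.intro)
    show "\<phi> \<in> hom T ?H" using iso by (simp add: iso_def)
    show "\<exists>p\<in>poly_funs (coords (gdim T)). \<forall>g\<in>carrier T. \<phi> g j = p g" if "j < 2 * n" for j
      using m1 that unfolding morphism_def dim by blast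
    have "?i ` carrier ?H = carrier T" using iso' by (simp add: iso_def bij_betw_def)
    then show "(\<lambda>s. ?i (emb n s)) ` torus n = carrier T"
      unfolding emb_image[symmetric] by (simp add: image_image)
    show "?i (emb n (\<lambda>i. s i * t i)) = ?i (emb n s) \<otimes>\<^bsub>T\<^esub> ?i (emb n t)"
      if "s \<in> torus n" "t \<in> torus n" for s t
      using iso' emb[OF that(1)] emb[OF that(2)] unfolding emb_mult by (simp add: iso_def hom_def)
    show "\<exists>p\<in>poly_funs (coords (2 * n)). \<forall>s\<in>torus n. ?i (emb n s) j = p (emb n s)" if "j < gdim T" for j
      using m2 that emb unfolding morphism_def dim by blast
    show "\<phi> (?i (emb n s)) = emb n s" if "s \<in> torus n" for s
      using bij_betw_inv_into_right[OF bij emb[OF that]] .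
  qed (rule gr)
  then show ?thesis by blast
qed

context torus_parametrization
begin

lemma psi_carrier: "s \<in> torus n \<Longrightarrow> \<psi> s \<in> carrier T"
  using psi_image by blast

text \<open>The conditions \<open>coord\<close> and \<open>weight\<close> of
  \<open>toric_map\<close> for a single factor. The last clause keeps \<open>W\<close> from being
  too large: each member has to be a polynomial function on the orbit.\<close>

definition orbit_weights :: "'k gvar \<Rightarrow> (nat \<Rightarrow> 'k) \<Rightarrow> (nat \<Rightarrow> int) set \<Rightarrow> bool" where
  "orbit_weights X x W \<longleftrightarrow> finite W \<and> W \<subseteq> weights n \<and>
     (\<forall>j<vdim X. \<exists>c. \<forall>s\<in>torus n. act X (\<psi> s) x j = (\<Sum>w\<in>W. c w * ch n w s)) \<and>
     (\<forall>w\<in>W. \<exists>q\<in>poly_funs (coords (vdim X)). \<forall>s\<in>torus n. q (act X (\<psi> s) x) = ch n w s)"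

lemma exists_orbit_weights:
  assumes X: "affine_G_variety T X" and x: "x \<in> pts X"
  shows "\<exists>W. orbit_weights X x W"
proof -
  interpret group_action T "pts X" "act X" using X by (simp add: affine_G_variety_def)
  let ?D = "coords (vdim X) :: ((nat \<Rightarrow> 'k) \<Rightarrow> 'k) set"
  define R where "R j K b \<longleftrightarrow> finite K \<and> K \<subseteq> weights n \<and> (\<forall>u\<in>K. b u \<in> poly_funs ?D) \<and>
      (\<forall>s\<in>torus n. \<forall>y\<in>pts X. act X (\<psi> s) y j = (\<Sum>u\<in>K. b u y * ch n u s))" for j K b
  have "\<exists>K b. R j K b" if j: "j < vdim X" for j
  proof -
    obtain p where p: "p \<in> poly_funs (pair_coords (coords (gdim T)) ?D)"
      "\<And>g y. g \<in> carrier T \<Longrightarrow> y \<in> pts X \<Longrightarrow> act X g y j = p (g, y)"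
      using X j unfolding affine_G_variety_def morphism_def by fastforce
    have "\<exists>K. finite K \<and> K \<subseteq> weights n \<and> laurent (torus n) (ch n) ?D K (\<lambda>s y. p (\<psi> s, y))"
    proof (rule laurent_poly[OF p(1)])
      fix f :: "(nat \<Rightarrow> 'k) \<times> (nat \<Rightarrow> 'k) \<Rightarrow> 'k"
      assume "f \<in> pair_coords (coords (gdim T)) ?D"
      then consider l where "l < gdim T" "f = (\<lambda>z. fst z l)" | h where "h \<in> ?D" "f = (\<lambda>z. h (snd z))"
        unfolding pair_coords_def coords_def by auto
      then show "\<exists>K. finite K \<and> K \<subseteq> weights n \<and> laurent (torus n) (ch n) ?D K (\<lambda>s y. f (\<psi> s, y))"
      proof cases
        case (1 l)
        obtain q where q: "q \<in> poly_funs (coords (2 * n))" "\<And>s. s \<in> torus n \<Longrightarrow> \<psi> s l = q (emb n s)"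
          using psi_poly[OF 1(1)] by blast
        obtain K where K: "finite K" "K \<subseteq> weights n" "laurent (torus n) (ch n) ?D K (\<lambda>s y. q (emb n s))"
          using emb_poly_laurent[OF q(1)] by blast
        then have "laurent (torus n) (ch n) ?D K (\<lambda>s y. f (\<psi> s, y))"
          unfolding laurent_def 1(2) by (simp add: q(2))
        then show ?thesis using K by blast
      next
        case (2 h)
        have "laurent (torus n) (ch n) ?D {0} (\<lambda>s y. h y * ch n 0 s)"
          using 2(1) by (intro laurent_const poly_funs.coord)
        then show ?thesis
          using 2(2) by (intro exI[of _ "{0}"]) (simp add: ch_0 weights_0)
      qed
    qed (auto intro: weights_0 weights_add ch_0 ch_add)
    then obtain K where K: "finite K" "K \<subseteq> weights n"
      and "laurent (torus n) (ch n) ?D K (\<lambda>s y. p (\<psi> s, y))"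
      by blast
    then obtain b where "\<forall>u\<in>K. b u \<in> poly_funs ?D"
      "\<forall>s\<in>torus n. \<forall>y. p (\<psi> s, y) = (\<Sum>u\<in>K. b u y * ch n u s)"
      unfolding laurent_def by blast
    with K show ?thesis
      unfolding R_def by (intro exI[of _ K] exI[of _ b]) (simp add: p(2) psi_carrier)
  qed
  then obtain K b where "\<And>j. j < vdim X \<Longrightarrow> R j (K j) (b j)"
    by metis
  then have K: "\<And>j. j < vdim X \<Longrightarrow> finite (K j)" "\<And>j. j < vdim X \<Longrightarrow> K j \<subseteq> weights n"
    "\<And>j u. j < vdim X \<Longrightarrow> u \<in> K j \<Longrightarrow> b j u \<in> poly_funs ?D"
    "\<And>j s y. j < vdim X \<Longrightarrow> s \<in> torus n \<Longrightarrow> y \<in> pts X \<Longrightarrow>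
      act X (\<psi> s) y j = (\<Sum>u\<in>K j. b j u y * ch n u s)"
    unfolding R_def by blast+
  \<comment> \<open>Both \<open>s\<close> acting on \<open>t \<cdot> x\<close> and
    \<open>s t\<close> acting on \<open>x\<close> are expanded as functions of \<open>s\<close> and
    compared term by term.\<close>
  have semi: "b j u (act X (\<psi> t) x) = b j u x * ch n u t"
    if j: "j < vdim X" and u: "u \<in> K j" and t: "t \<in> torus n" for j u t
  proof -
    have tx: "act X (\<psi> t) x \<in> pts X" using element_image[OF psi_carrier[OF t] x] by simp
    have "b j u (act X (\<psi> t) x) - b j u x * ch n u t = 0"
    proof (rule ch_independent[OF K(1)[OF j] K(2)[OF j] _ u])
      fix s :: "nat \<Rightarrow> 'k" assume s: "s \<in> torus n"
      have "act X (\<psi> s) (act X (\<psi> t) x) = act X (\<psi> (\<lambda>i. s i * t i)) x"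
        unfolding psi_mult[OF s t] using composition_rule[OF x psi_carrier[OF s] psi_carrier[OF t]] by simp
      then have "(\<Sum>u\<in>K j. b j u (act X (\<psi> t) x) * ch n u s)
          = (\<Sum>u\<in>K j. b j u x * ch n u (\<lambda>i. s i * t i))"
        using K(4)[OF j s tx] K(4)[OF j torus_mult[OF s t] x] by simp
      then show "(\<Sum>u\<in>K j. (b j u (act X (\<psi> t) x) - b j u x * ch n u t) * ch n u s) = 0"
        unfolding left_diff_distrib sum_subtractf by (simp add: ch_mult mult_ac)
    qed
    then show ?thesis by simp
  qed
  \<comment> \<open>Only weights whose coefficient is nonzero at \<open>x\<close> are kept: by
    \<open>semi\<close> these coefficients become characters on the orbit after division, and the
    others contribute nothing.\<close>
  define W where "W = (\<Union>j<vdim X. {u \<in> K j. b j u x \<noteq> 0})"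
  have fin: "finite W" unfolding W_def using K(1) by auto
  have "orbit_weights X x W"
    unfolding orbit_weights_def
  proof (intro conjI allI impI ballI fin)
    show "W \<subseteq> weights n" unfolding W_def using K(2) by blast
    fix j assume j: "j < vdim X"
    have "act X (\<psi> s) x j = (\<Sum>w\<in>W. (if w \<in> K j then b j w x else 0) * ch n w s)" if s: "s \<in> torus n" for s
    proof -
      have "(\<Sum>w\<in>W. (if w \<in> K j then b j w x else 0) * ch n w s)
          = (\<Sum>u\<in>{u \<in> K j. b j u x \<noteq> 0}. b j u x * ch n u s)"
        using fin j by (intro sum.mono_neutral_cong_right) (auto simp: W_def)
      also have "\<dots> = (\<Sum>u\<in>K j. b j u x * ch n u s)"
        using K(1)[OF j] by (intro sum.mono_neutral_left) auto
      finally show ?thesis using K(4)[OF j s x] by simp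
    qed
    then show "\<exists>c. \<forall>s\<in>torus n. act X (\<psi> s) x j = (\<Sum>w\<in>W. c w * ch n w s)"
      by (intro exI[of _ "\<lambda>w. if w \<in> K j then b j w x else 0"]) simp
  next
    fix w assume "w \<in> W"
    then obtain j where j: "j < vdim X" "w \<in> K j" "b j w x \<noteq> 0" unfolding W_def by blast
    show "\<exists>q\<in>poly_funs ?D. \<forall>s\<in>torus n. q (act X (\<psi> s) x) = ch n w s"
      using semi[OF j(1,2)] j(3) poly_funs_cmult[OF K(3)[OF j(1,2)], of "inverse (b j w x)"]
      by (intro bexI[of _ "\<lambda>y. inverse (b j w x) * b j w y"]) auto
  qed
  then show ?thesis by blast
qed

section \<open>Orbits in finite products of varieties\<close>

lemma diag_orbit:
  assumes "x \<in> prod_pts I X"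
  shows "prod_orbit T I X x = (\<lambda>s. \<lambda>i\<in>I. act (X i) (\<psi> s) (x i)) ` torus n"
proof -
  have "prod_orbit T I X x = (\<lambda>g. \<lambda>i\<in>I. act (X i) g (x i)) ` carrier T"
    unfolding prod_orbit_def orbit_def diag_act_def using assms by auto
  then show ?thesis unfolding psi_image[symmetric] image_image .
qed

context
  fixes m :: "nat set" and X :: "nat \<Rightarrow> 'k gvar" and x :: "nat \<Rightarrow> nat \<Rightarrow> 'k"
    and W :: "nat \<Rightarrow> (nat \<Rightarrow> int) set"
  assumes X: "\<And>i. i \<in> m \<Longrightarrow> affine_G_variety T (X i)" and x: "x \<in> prod_pts m X"
    and W: "\<And>i. i \<in> m \<Longrightarrow> orbit_weights (X i) (x i) (W i)" and finite_m: "finite m"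
begin

abbreviation prod_coords :: "nat set \<Rightarrow> ((nat \<Rightarrow> nat \<Rightarrow> 'k) \<Rightarrow> 'k) set" where
  "prod_coords I \<equiv> {\<lambda>x. f (x i) | i f. i \<in> I \<and> f \<in> coords (vdim (X i))}"

lemma pts_affine:
  assumes "i \<in> m"
  shows "pts (X i) \<subseteq> affine_space (vdim (X i))"
proof -
  have "closedin (zariski (affine_space (vdim (X i))) (coords (vdim (X i)))) (pts (X i))"
    using X[OF assms] by (simp add: affine_G_variety_def affine_variety_def)
  from closedin_subset[OF this] show ?thesis unfolding topspace_zariski .
qed

lemma poly_funs_factor:
  assumes "p \<in> poly_funs (coords (vdim (X i)))" "i \<in> I"
  shows "(\<lambda>x. p (x i)) \<in> poly_funs (prod_coords I)"
  using assms by (intro poly_funs_comp[OF assms(1)] poly_funs.coord) blast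

lemma toric_map_prod:
  assumes I: "I \<subseteq> m"
  shows "toric_map n (prod_pts I X) (prod_coords I) (\<lambda>s. \<lambda>i\<in>I. act (X i) (\<psi> s) (x i)) (\<Union>i\<in>I. W i)"
proof
  fix s :: "nat \<Rightarrow> 'k" assume s: "s \<in> torus n"
  have "act (X i) (\<psi> s) (x i) \<in> pts (X i)" if "i \<in> I" for i
  proof -
    interpret group_action T "pts (X i)" "act (X i)" using X I that by (auto simp: affine_G_variety_def)
    show ?thesis
      using element_image[OF psi_carrier[OF s], of "x i"] x I that by (auto simp: prod_pts_def)
  qed
  then show "(\<lambda>i\<in>I. act (X i) (\<psi> s) (x i)) \<in> prod_pts I X" by (simp add: prod_pts_def)
next
  show "finite (\<Union>i\<in>I. W i)"
    using W I finite_subset[OF I finite_m] by (auto simp: orbit_weights_def)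
  show "(\<Union>i\<in>I. W i) \<subseteq> weights n"
    using W I by (fastforce simp: orbit_weights_def)
next
  fix g assume "g \<in> prod_coords I"
  then obtain i j where ij: "i \<in> I" "j < vdim (X i)" "g = (\<lambda>x. x i j)" by (auto simp: coords_def)
  then obtain c where c: "\<forall>s\<in>torus n. act (X i) (\<psi> s) (x i) j = (\<Sum>w\<in>W i. c w * ch n w s)"
    using W I unfolding orbit_weights_def by blast
  have "(\<Sum>w\<in>W i. c w * ch n w s) = (\<Sum>w\<in>(\<Union>i\<in>I. W i). (if w \<in> W i then c w else 0) * ch n w s)" for s
    using ij(1) W I finite_subset[OF I finite_m]
    by (intro sum.mono_neutral_cong_left) (auto simp: orbit_weights_def)
  then show "\<exists>c. \<forall>s\<in>torus n. g (\<lambda>i\<in>I. act (X i) (\<psi> s) (x i)) = (\<Sum>w\<in>(\<Union>i\<in>I. W i). c w * ch n w s)"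
    using c ij by (intro exI[of _ "\<lambda>w. if w \<in> W i then c w else 0"]) simp
next
  fix w assume "w \<in> (\<Union>i\<in>I. W i)"
  then obtain i where i: "i \<in> I" "w \<in> W i" by blast
  then obtain q where q: "q \<in> poly_funs (coords (vdim (X i)))" "\<forall>s\<in>torus n. q (act (X i) (\<psi> s) (x i)) = ch n w s"
    using W I unfolding orbit_weights_def by blast
  then show "\<exists>q\<in>poly_funs (prod_coords I). \<forall>s\<in>torus n. q (\<lambda>i\<in>I. act (X i) (\<psi> s) (x i)) = ch n w s"
    using i(1) by (intro bexI[of _ "\<lambda>x. q (x i)"] poly_funs_factor) auto
next
  fix y z assume yz: "y \<in> prod_pts I X" "z \<in> prod_pts I X" "\<And>g. g \<in> prod_coords I \<Longrightarrow> g y = g z"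
  show "y = z"
  proof (rule PiE_ext[OF yz(1)[unfolded prod_pts_def] yz(2)[unfolded prod_pts_def]])
    fix i assume i: "i \<in> I"
    have "y i \<in> affine_space (vdim (X i))" "z i \<in> affine_space (vdim (X i))"
      using PiE_mem[OF yz(1)[unfolded prod_pts_def] i] PiE_mem[OF yz(2)[unfolded prod_pts_def] i]
        pts_affine[OF subsetD[OF I i]] by auto
    then show "y i = z i"
      unfolding affine_space_def
    proof (rule PiE_ext)
      fix j assume "j \<in> {..<vdim (X i)}"
      then have "(\<lambda>x. x i j) \<in> prod_coords I"
        using i by (intro CollectI exI[of _ i] exI[of _ "\<lambda>y. y j"]) (auto simp: coords_def)
      then show "y i j = z i j" by (rule yz(3))
    qed
  qed
qed

text \<open>The limit point behind \<open>closed_only_if\<close> is found in the ambient affine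
  space, so the product must be exhibited as the zero set of equations there; those of the factors,
  pulled back, serve.\<close>

lemma prod_pts_zero_set:
  assumes I: "I \<subseteq> m"
  shows "\<exists>F\<subseteq>poly_funs (prod_coords I).
    prod_pts I X = zero_set (\<Pi>\<^sub>E i\<in>I. affine_space (vdim (X i))) F"
proof -
  have "\<exists>F\<subseteq>poly_funs (coords (vdim (X i))). pts (X i) = zero_set (affine_space (vdim (X i))) F" if "i \<in> I" for i
    using X that I unfolding affine_G_variety_def affine_variety_def closedin_zariski by blast
  then obtain F where F: "\<And>i. i \<in> I \<Longrightarrow> F i \<subseteq> poly_funs (coords (vdim (X i)))"
    "\<And>i. i \<in> I \<Longrightarrow> pts (X i) = zero_set (affine_space (vdim (X i))) (F i)"
    by metis
  let ?G = "\<Union>i\<in>I. (\<lambda>p x. p (x i)) ` F i"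
  have "?G \<subseteq> poly_funs (prod_coords I)"
    using F(1) poly_funs_factor by (intro UN_least image_subsetI) blast
  moreover have "prod_pts I X = zero_set (\<Pi>\<^sub>E i\<in>I. affine_space (vdim (X i))) ?G"
  proof (rule Set.set_eqI)
    fix y :: "nat \<Rightarrow> nat \<Rightarrow> 'k"
    have "y \<in> zero_set (\<Pi>\<^sub>E i\<in>I. affine_space (vdim (X i))) ?G \<longleftrightarrow>
        y \<in> (\<Pi>\<^sub>E i\<in>I. affine_space (vdim (X i))) \<and> (\<forall>i\<in>I. \<forall>p\<in>F i. p (y i) = 0)"
      unfolding zero_set_def by simp
    also have "\<dots> \<longleftrightarrow> y \<in> extensional I \<and> (\<forall>i\<in>I. y i \<in> zero_set (affine_space (vdim (X i))) (F i))"
      unfolding zero_set_def PiE_iff by blast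
    also have "\<dots> \<longleftrightarrow> y \<in> prod_pts I X"
      using F(2) by (auto simp: prod_pts_def PiE_iff)
    finally show "y \<in> prod_pts I X \<longleftrightarrow> y \<in> zero_set (\<Pi>\<^sub>E i\<in>I. affine_space (vdim (X i))) ?G"
      by simp
  qed
  ultimately show ?thesis by blast
qed

lemma restrict_prod_pts: "I \<subseteq> m \<Longrightarrow> restrict x I \<in> prod_pts I X"
  using x by (auto simp: prod_pts_def)

lemma restrict_orbit:
  assumes "I \<subseteq> m"
  shows "prod_orbit T I X (restrict x I) = (\<lambda>s. \<lambda>i\<in>I. act (X i) (\<psi> s) (x i)) ` torus n"
proof -
  have eq: "(\<lambda>s. \<lambda>i\<in>I. act (X i) (\<psi> s) (restrict x I i)) = (\<lambda>s. \<lambda>i\<in>I. act (X i) (\<psi> s) (x i))"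
    by (auto intro!: ext)
  show ?thesis unfolding diag_orbit[OF restrict_prod_pts[OF assms]] eq by (rule refl)
qed

lemma closed_orbit_iff:
  assumes I: "I \<subseteq> m"
  shows "closed_orbit T I X (restrict x I) \<longleftrightarrow>
    (\<forall>w\<in>(\<Union>i\<in>I. W i). - w \<in> mon_hull (\<Union>i\<in>I. W i))"
proof -
  interpret toric_map n "prod_pts I X" "prod_coords I" "\<lambda>s. \<lambda>i\<in>I. act (X i) (\<psi> s) (x i)" "\<Union>i\<in>I. W i"
    by (rule toric_map_prod[OF I])
  have ex: "\<exists>y\<in>(\<Pi>\<^sub>E i\<in>I. affine_space (vdim (X i))). \<forall>g\<in>prod_coords I. g y = v g" for v
    by (intro bexI[of _ "\<lambda>i\<in>I. \<lambda>j\<in>{..<vdim (X i)}. v (\<lambda>x. x i j)"])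
      (auto simp: coords_def affine_space_def)
  obtain F where F: "F \<subseteq> poly_funs (prod_coords I)"
    "prod_pts I X = zero_set (\<Pi>\<^sub>E i\<in>I. affine_space (vdim (X i))) F"
    using prod_pts_zero_set[OF I] by blast
  show ?thesis
    unfolding closed_orbit_def restrict_orbit[OF I] prod_zariski_def
    using closed_if closed_only_if[OF F(2,1) ex] by blast
qed

lemma orbit_dim_eq:
  assumes I: "I \<subseteq> m" and closed: "closed_orbit T I X (restrict x I)"
  shows "orbit_dim T I X (restrict x I) = enat (card (leading (mon_hull (\<Union>i\<in>I. W i))))"
proof -
  interpret toric_map n "prod_pts I X" "prod_coords I" "\<lambda>s. \<lambda>i\<in>I. act (X i) (\<psi> s) (x i)" "\<Union>i\<in>I. W i"
    by (rule toric_map_prod[OF I])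
  show ?thesis
    unfolding orbit_dim_def restrict_orbit[OF I] prod_zariski_def
    using krull_dim_orbit closed closed_orbit_iff[OF I] by blast
qed

end

end


context torus_parametrization
begin

section \<open>The upper bound\<close>

lemma delta_prod_le:
  assumes X: "\<And>i. i \<in> {1..m} \<Longrightarrow> affine_G_variety T (X i)"
  shows "delta_prod T m X \<le> 2 * n"
proof (cases "m \<le> 2 * n")
  case True
  \<comment> \<open>A subset must have exactly the prescribed size, so with at most
    \<open>2 * n\<close> factors the full set is taken instead.\<close>
  have "delta_prod T m X \<le> m"
    unfolding delta_prod_def by (rule Least_le) (rule delta_prod_bound_full)
  with True show ?thesis by simp
next
  case False
  have "delta_prod_bound T m X (2 * n)"
    unfolding delta_prod_bound_def
  proof (intro ballI impI)
    fix x assume x: "x \<in> prod_pts {1..m} X" and closed: "closed_orbit T {1..m} X x"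
    have "\<exists>W. orbit_weights (X i) (x i) W" if "i \<in> {1..m}" for i
      using exists_orbit_weights[OF X[OF that] PiE_mem[OF x[unfolded prod_pts_def] that]] .
    then obtain W where W: "\<And>i. i \<in> {1..m} \<Longrightarrow> orbit_weights (X i) (x i) (W i)" by metis
    note iff = closed_orbit_iff[OF X x W finite_atLeastAtMost]
    note dim = orbit_dim_eq[OF X x W finite_atLeastAtMost]
    let ?W = "\<lambda>I. \<Union>i\<in>I. W i"
    have res: "restrict x {1..m} = x"
      using x unfolding prod_pts_def by (rule PiE_restrict)
    have neg: "- w \<in> mon_hull (?W {1..m})" if "w \<in> ?W {1..m}" for w
      using iff[of "{1..m}"] closed that unfolding res by blast
    have fin: "finite (?W {1..m})" and wts: "?W {1..m} \<subseteq> weights n"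
      using W unfolding orbit_weights_def by (simp, blast)
    obtain V where V: "V \<subseteq> ?W {1..m}" "card V \<le> 2 * n"
      and span: "\<And>U. V \<subseteq> U \<Longrightarrow> U \<subseteq> ?W {1..m} \<Longrightarrow>
        (\<forall>u\<in>U. - u \<in> mon_hull U) \<and> (\<forall>w\<in>?W {1..m}. \<exists>N>0. smul N w \<in> mon_hull U)"
      using steinitz[OF fin wts neg] by metis
    have "\<forall>v\<in>V. \<exists>i\<in>{1..m}. v \<in> W i" using V(1) by blast
    \<comment> \<open>One factor is picked for each vector. Several vectors may share a factor, so
      the choice is padded to exactly \<open>2 * n\<close> factors, which \<open>span\<close>
      allows.\<close>
    then obtain \<iota> where \<iota>: "\<And>v. v \<in> V \<Longrightarrow> \<iota> v \<in> {1..m}" "\<And>v. v \<in> V \<Longrightarrow> v \<in> W (\<iota> v)" by metis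
    have "card (\<iota> ` V) \<le> 2 * n"
      using card_image_le[OF finite_subset[OF V(1) fin], of \<iota>] V(2) by linarith
    moreover have "\<iota> ` V \<subseteq> {1..m}" using \<iota>(1) by blast
    ultimately obtain I where I: "\<iota> ` V \<subseteq> I" "I \<subseteq> {1..m}" "card I = 2 * n"
      using exists_subset_between[of "\<iota> ` V" "2 * n" "{1..m}"] False by auto
    have U: "V \<subseteq> ?W I" "?W I \<subseteq> ?W {1..m}" using I \<iota>(2) by blast+
    have c: "closed_orbit T I X (restrict x I)"
      using iff[OF _ _ I(2)] span[OF U] by blast
    moreover have "orbit_dim T I X (restrict x I) = orbit_dim T {1..m} X x"
    proof -
      have "leading (mon_hull (?W I)) = leading (mon_hull (?W {1..m}))"
        using span[OF U] by (intro leading_mon_cong U(2)) blast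
      then show ?thesis
        using dim[OF _ _ I(2) c] dim[of "{1..m}"] closed unfolding res by simp
    qed
    ultimately show "\<exists>I\<subseteq>{1..m}. card I = 2 * n \<and> closed_orbit T I X (restrict x I) \<and>
        orbit_dim T I X (restrict x I) = orbit_dim T {1..m} X x"
      using I by blast
  qed
  then show ?thesis unfolding delta_prod_def by (rule Least_le)
qed

section \<open>The lower bound\<close>

text \<open>
  The \<open>2n\<close> characters \<open>t\<^sub>1, \<dots>, t\<^sub>n, t\<^sub>1\<^sup>-\<^sup>1, \<dots>, t\<^sub>n\<^sup>-\<^sup>1\<close> acting on lines; factor \<open>i\<close> of the product
  belongs to the coordinate \<open>i - 1\<close> of the standard torus.
\<close>

definition line :: "nat \<Rightarrow> 'k gvar" where
  "line i = \<lparr>vdim = 1, pts = affine_space 1,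
     act = (\<lambda>t. \<lambda>x\<in>affine_space 1. \<lambda>j\<in>{..<1}. \<phi> t (i - 1) * x 0)\<rparr>"

lemma phi_coord_mult:
  assumes "g \<in> carrier T" "h \<in> carrier T" "j < 2 * n"
  shows "\<phi> (g \<otimes>\<^bsub>T\<^esub> h) j = \<phi> g j * \<phi> h j"
  using hom_mult[OF phi_hom assms(1,2)] assms(3) by (simp add: std_torus_def)

lemma phi_coord_one:
  assumes "j < 2 * n"
  shows "\<phi> \<one>\<^bsub>T\<^esub> j = 1"
proof -
  interpret group T by (rule group_T)
  have "\<one>\<^bsub>T\<^esub> \<in> \<psi> ` torus n" unfolding psi_image by (rule one_closed)
  then obtain s where s: "s \<in> torus n" "\<psi> s = \<one>\<^bsub>T\<^esub>" by auto
  have "\<phi> \<one>\<^bsub>T\<^esub> j \<noteq> 0"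
    using phi_psi[OF s(1)] s assms by (auto simp: emb_def torus_def)
  moreover have "\<phi> \<one>\<^bsub>T\<^esub> j * \<phi> \<one>\<^bsub>T\<^esub> j = \<phi> \<one>\<^bsub>T\<^esub> j"
    using phi_coord_mult[OF one_closed one_closed assms] by simp
  ultimately show ?thesis by simp
qed

lemma affine_space_1_eq: "x \<in> affine_space 1 \<longleftrightarrow> x = (\<lambda>j\<in>{..<1}. x 0)"
  unfolding affine_space_def by (auto simp: PiE_iff extensional_def fun_eq_iff)

lemma line_affine_G_variety:
  assumes i: "i \<in> {1..2 * n}"
  shows "affine_G_variety T (line i)"
proof -
  interpret group T by (rule group_T)
  let ?E = "affine_space 1 :: (nat \<Rightarrow> 'k) set" and ?a = "act (line i)"
  define l where "l = i - Suc 0"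
  have l: "l < 2 * n" using i by (auto simp: l_def)
  have maps: "?a g x \<in> ?E" if "x \<in> ?E" for g x
    using that by (simp add: line_def affine_space_def)
  have act0: "?a g x = (\<lambda>j\<in>{..<1}. \<phi> g l * x 0)" if "x \<in> ?E" for g x
    using that by (simp add: line_def l_def)
  have mult: "?a (g \<otimes>\<^bsub>T\<^esub> h) x = ?a g (?a h x)" if "g \<in> carrier T" "h \<in> carrier T" "x \<in> ?E" for g h x
    using that maps[OF that(3), of h] by (simp add: act0 phi_coord_mult l mult.assoc)
  have one: "?a \<one>\<^bsub>T\<^esub> x = x" if "x \<in> ?E" for x
    using that affine_space_1_eq[of x] by (simp add: act0 phi_coord_one l)
  have Bij: "?a g \<in> Bij ?E" if g: "g \<in> carrier T" for g
  proof -
    have "bij_betw (?a g) ?E ?E"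
    proof (rule bij_betw_byWitness[where f' = "?a (inv\<^bsub>T\<^esub> g)"])
      show "\<forall>x\<in>?E. ?a (inv\<^bsub>T\<^esub> g) (?a g x) = x" "\<forall>x\<in>?E. ?a g (?a (inv\<^bsub>T\<^esub> g) x) = x"
        using g by (simp_all add: one flip: mult)
    qed (use maps in auto)
    moreover have "?a g \<in> extensional ?E" by (simp add: line_def)
    ultimately show ?thesis by (simp add: Bij_def)
  qed
  have "?a \<in> hom T (BijGroup ?E)"
  proof (rule homI)
    show "?a g \<in> carrier (BijGroup ?E)" if "g \<in> carrier T" for g
      using Bij[OF that] by (simp add: BijGroup_def)
    show "?a (g \<otimes>\<^bsub>T\<^esub> h) = ?a g \<otimes>\<^bsub>BijGroup ?E\<^esub> ?a h" if "g \<in> carrier T" "h \<in> carrier T" for g h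
    proof (rule extensionalityI[of _ ?E])
      show "?a (g \<otimes>\<^bsub>T\<^esub> h) \<in> extensional ?E" by (simp add: line_def)
      show "?a g \<otimes>\<^bsub>BijGroup ?E\<^esub> ?a h \<in> extensional ?E"
        using Bij that by (simp add: BijGroup_def compose_def)
      show "?a (g \<otimes>\<^bsub>T\<^esub> h) x = (?a g \<otimes>\<^bsub>BijGroup ?E\<^esub> ?a h) x" if "x \<in> ?E" for x
        using Bij \<open>g \<in> carrier T\<close> \<open>h \<in> carrier T\<close> that by (simp add: BijGroup_def compose_def mult)
    qed
  qed
  then have "group_action T ?E ?a"
    using group_T group_BijGroup by (simp add: group_action_def group_hom_def group_hom_axioms_def)
  moreover have "affine_variety 1 ?E"
    unfolding affine_variety_def using closedin_topspace[of "zariski ?E (coords 1)"]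
    unfolding topspace_zariski .
  moreover have "morphism (carrier T \<times> ?E) (pair_coords (coords (gdim T)) (coords 1)) 1 ?E (\<lambda>(g, x). ?a g x)"
    unfolding morphism_def
  proof (intro conjI allI impI)
    show "(\<lambda>(g, x). ?a g x) \<in> carrier T \<times> ?E \<rightarrow> ?E" using maps by auto
    fix j :: nat assume j: "j < 1"
    let ?C = "pair_coords (coords (gdim T)) (coords 1) :: ((nat \<Rightarrow> 'k) \<times> (nat \<Rightarrow> 'k) \<Rightarrow> 'k) set"
    obtain p where p: "p \<in> poly_funs (coords (gdim T))" "\<And>g. g \<in> carrier T \<Longrightarrow> \<phi> g l = p g"
      using phi_poly[OF l] by blast
    have "(\<lambda>z. p (fst z)) \<in> poly_funs ?C"
      by (rule poly_funs_comp[OF p(1)]) (auto simp: pair_coords_def intro: poly_funs.coord)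
    moreover have "(\<lambda>z. snd z 0) \<in> poly_funs ?C"
      by (intro poly_funs.coord) (auto simp: pair_coords_def coords_def)
    ultimately have "(\<lambda>z. p (fst z) * snd z 0) \<in> poly_funs ?C"
      by (rule poly_funs.mult)
    then show "\<exists>p\<in>poly_funs ?C. \<forall>z\<in>carrier T \<times> ?E. (case z of (g, x) \<Rightarrow> ?a g x) j = p z"
      using j by (intro bexI[of _ "\<lambda>z. p (fst z) * snd z 0"]) (auto simp: act0 p(2))
  qed
  moreover have "vdim (line i) = 1" "pts (line i) = ?E" by (simp_all add: line_def)
  ultimately show ?thesis
    unfolding affine_G_variety_def by metis
qed

text \<open>At the point \<open>1\<close> of the line the coordinate is nonzero, so the character
  through which \<open>T\<close> acts occurs as a weight.\<close>

lemma line_orbit_weights: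
  assumes i: "i \<in> {1..2 * n}"
  shows "orbit_weights (line i) (\<lambda>j\<in>{..<1}. 1) {emb_weight n (i - 1)}"
proof -
  have l: "i - 1 < 2 * n" using i by auto
  have "(\<lambda>j\<in>{..<1}. 1 :: 'k) \<in> affine_space 1" by (simp add: affine_space_def)
  then have act: "act (line i) (\<psi> s) (\<lambda>j\<in>{..<1}. 1) 0 = ch n (emb_weight n (i - 1)) s" if "s \<in> torus n" for s
    unfolding ch_emb_weight[OF l] using that by (simp add: line_def phi_psi)
  have dim: "vdim (line i) = 1" by (simp add: line_def)
  show ?thesis
    unfolding orbit_weights_def dim
  proof (intro conjI allI impI ballI)
    show "{emb_weight n (i - 1)} \<subseteq> weights n" using emb_weight_weights[OF l] by simp
    show "\<exists>c. \<forall>s\<in>torus n. act (line i) (\<psi> s) (\<lambda>j\<in>{..<1}. 1) j = (\<Sum>w\<in>{emb_weight n (i - 1)}. c w * ch n w s)"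
      if "j < 1" for j
      using that act by (intro exI[of _ "\<lambda>_. 1"]) simp
    show "\<exists>q\<in>poly_funs (coords 1). \<forall>s\<in>torus n. q (act (line i) (\<psi> s) (\<lambda>j\<in>{..<1}. 1)) = ch n w s"
      if "w \<in> {emb_weight n (i - 1)}" for w
      using that act by (intro bexI[of _ "\<lambda>y. y 0"] poly_funs.coord) (auto simp: coords_def)
  qed simp
qed

lemma emb_weight_minus:
  assumes "j < 2 * n"
  shows "- emb_weight n j \<in> emb_weight n ` {..<2 * n}"
proof -
  have "- emb_weight n j = emb_weight n (if j < n then j + n else j - n)"
    using assms by (auto simp: emb_weight_def uminus_apply)
  then show ?thesis using assms by auto
qed

lemma leading_all: "leading (mon_hull (emb_weight n ` {..<2 * n})) = {..<n}"
proof
  have "emb_weight n ` {..<2 * n} \<subseteq> weights n" using emb_weight_weights by auto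
  then show "leading (mon_hull (emb_weight n ` {..<2 * n})) \<subseteq> {..<n}"
    by (intro leading_weights mon_weights)
  show "{..<n} \<subseteq> leading (mon_hull (emb_weight n ` {..<2 * n}))"
  proof
    fix j assume "j \<in> {..<n}"
    then have "emb_weight n j \<in> mon_hull (emb_weight n ` {..<2 * n})" "emb_weight n j j \<noteq> 0"
      "\<forall>i>j. emb_weight n j i = 0"
      by (auto simp: emb_weight_def intro!: mon_base)
    then show "j \<in> leading (mon_hull (emb_weight n ` {..<2 * n}))" unfolding leading_def by blast
  qed
qed

text \<open>Without the vector of index \<open>j\<close> all remaining ones have their
  \<open>l\<close>-th entry on one side of zero, hence so do all sums; in a monoid closed under
  negation this entry must then vanish, and \<open>l\<close> is no leading index.\<close>

lemma card_leading_missing: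
  assumes J: "J \<subseteq> {..<2 * n}" "j < 2 * n" "j \<notin> J"
    and neg: "\<And>u. u \<in> emb_weight n ` J \<Longrightarrow> - u \<in> mon_hull (emb_weight n ` J)"
  shows "card (leading (mon_hull (emb_weight n ` J))) < n"
proof -
  let ?M = "mon_hull (emb_weight n ` J)"
  define l where "l = (if j < n then j else j - n)"
  define e :: int where "e = (if j < n then 1 else -1)"
  have l: "l < n" using J(2) by (auto simp: l_def)
  have "?M \<subseteq> {u. e * u l \<le> 0}"
  proof (rule mon_least)
    show "emb_weight n ` J \<subseteq> {u. e * u l \<le> 0}"
    proof safe
      fix k assume "k \<in> J"
      then have "k \<noteq> j" "k < 2 * n" using J by auto
      then show "e * emb_weight n k l \<le> 0"
        using J(2) by (auto simp: e_def l_def emb_weight_def split: if_splits)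
    qed
  qed (auto simp: zero_fun_apply plus_fun_apply distrib_left)
  then have le: "e * u l \<le> 0" if "u \<in> ?M" for u using that by blast
  have "u l = 0" if u: "u \<in> ?M" for u
  proof -
    have "- u \<in> ?M" by (rule mon_minus[OF _ u]) (rule neg)
    from le[OF this] le[OF u] show ?thesis by (simp add: uminus_apply e_def split: if_splits)
  qed
  then have "l \<notin> leading ?M" unfolding leading_def by blast
  moreover have "leading ?M \<subseteq> {..<n}"
    using J(1) by (intro leading_weights mon_weights) (auto intro: emb_weight_weights)
  ultimately have "leading ?M \<subset> {..<n}" using l by blast
  from psubset_card_mono[OF _ this] show ?thesis by simp
qed

text \<open>At the point with all coordinates \<open>1\<close> the weights are all vectors
  \<open>\<plusminus>e_i\<close>, so its orbit is closed of dimension \<open>n\<close>; a proper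
  subset of the factors that still has a closed orbit has an orbit of smaller dimension.\<close>

lemma delta_prod_lines: "2 * n \<le> delta_prod T (2 * n) line"
proof (rule ccontr)
  define d where "d = delta_prod T (2 * n) line"
  assume "\<not> 2 * n \<le> delta_prod T (2 * n) line"
  then have d: "d < 2 * n" by (simp add: d_def)
  have bound: "delta_prod_bound T (2 * n) line d"
    unfolding d_def delta_prod_def by (rule LeastI) (rule delta_prod_bound_full)
  define x :: "nat \<Rightarrow> nat \<Rightarrow> 'k" where "x = (\<lambda>i\<in>{1..2 * n}. \<lambda>j\<in>{..<1}. 1)"
  define W where "W i = {emb_weight n (i - 1)}" for i
  have x: "x \<in> prod_pts {1..2 * n} line"
    by (auto simp: x_def prod_pts_def line_def affine_space_def)
  have W: "orbit_weights (line i) (x i) (W i)" if "i \<in> {1..2 * n}" for i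
    using line_orbit_weights[OF that] that by (simp add: x_def W_def)
  note iff = closed_orbit_iff[OF line_affine_G_variety x W finite_atLeastAtMost]
  note dim = orbit_dim_eq[OF line_affine_G_variety x W finite_atLeastAtMost]
  have res: "restrict x {1..2 * n} = x" by (simp add: x_def)
  have UW: "(\<Union>i\<in>I. W i) = emb_weight n ` ((\<lambda>i. i - 1) ` I)" for I
    by (auto simp: W_def)
  have all: "(\<lambda>i. i - 1) ` {1..2 * n} = {..<2 * n}"
    by (auto simp: image_iff intro!: bexI[of _ "Suc _"])
  have closed: "closed_orbit T {1..2 * n} line x"
    using iff[of "{1..2 * n}"] emb_weight_minus unfolding res UW all by (auto intro: mon_base)
  have dim_x: "orbit_dim T {1..2 * n} line x = enat n"
    using dim[of "{1..2 * n}"] closed unfolding res UW all by (simp add: leading_all)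
  obtain I where I: "I \<subseteq> {1..2 * n}" "card I = d" "closed_orbit T I line (restrict x I)"
    "orbit_dim T I line (restrict x I) = enat n"
    using bound x closed dim_x unfolding delta_prod_bound_def by auto
  have "I \<noteq> {1..2 * n}" using I(2) d by auto
  then obtain i where i: "i \<in> {1..2 * n}" "i \<notin> I" using I(1) by blast
  let ?J = "(\<lambda>i. i - 1) ` I"
  have "i - 1 \<notin> ?J"
  proof
    assume "i - 1 \<in> ?J"
    then obtain k where "k \<in> I" "i - 1 = k - 1" by blast
    \<comment> \<open>Truncated subtraction of \<open>1\<close> is injective here because the
      factors are numbered from \<open>1\<close>.\<close>
    moreover have "1 \<le> k" "1 \<le> i" using I(1) \<open>k \<in> I\<close> i(1) by auto
    ultimately show False using i(2) by (metis diff_add_inverse2 le_add_diff_inverse2)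
  qed
  moreover have "?J \<subseteq> {..<2 * n}"
    using image_mono[OF I(1), of "\<lambda>i. i - 1"] unfolding all .
  moreover have "i - 1 < 2 * n" using i(1) by auto
  moreover have "- u \<in> mon_hull (emb_weight n ` ?J)" if "u \<in> emb_weight n ` ?J" for u
    using iff[OF _ _ I(1)] I(3) that unfolding UW by blast
  ultimately have "card (leading (mon_hull (emb_weight n ` ?J))) < n"
    by (intro card_leading_missing)
  then show False using dim[OF _ _ I(1,3)] I(4) unfolding UW by simp
qed

lemma delta_eq: "delta T = enat (2 * n)"
  unfolding delta_def
proof (intro antisym Sup_least Sup_upper2)
  fix d assume "d \<in> {enat (delta_prod T m X) | m X. \<forall>i\<in>{1..m}. affine_G_variety T (X i)}"
  then show "d \<le> enat (2 * n)" using delta_prod_le by auto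
next
  show "enat (delta_prod T (2 * n) line) \<in> {enat (delta_prod T m X) | m X. \<forall>i\<in>{1..m}. affine_G_variety T (X i)}"
    using line_affine_G_variety by blast
  show "enat (2 * n) \<le> enat (delta_prod T (2 * n) line)" using delta_prod_lines by simp
qed

end

theorem proposition5p5:
  fixes T :: "'k::alg_closed_field alg_group" and n :: nat
  assumes "algebraic_torus n T"
  shows "delta T = enat (2 * n)"
proof -
  obtain \<phi> \<psi> where "torus_parametrization n T \<phi> \<psi>"
    using exists_torus_parametrization[OF assms] by blast
  then show ?thesis
    by (rule torus_parametrization.delta_eq)
qed

end
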